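(* For $n\ge 0$ define the polynomial $$\widetilde{Q}_n(x_1,x_2,\widetilde{y}_1,y_2,u_1,u_2,\widetilde{v}_1,v_2,\mathbf{w})=\sum_{\sigma\in\mathfrak{S}_n} x_1^{\mathrm{eareccpeak}(\sigma)}x_2^{\mathrm{eareccdfall}(\sigma)}\widetilde{y}_1^{\mathrm{minval}(\sigma)}y_2^{\mathrm{ereccdrise}(\sigma)}u_1^{\mathrm{nrcpeak}(\sigma)}u_2^{\mathrm{nrcdfall}(\sigma)}\widetilde{v}_1^{\mathrm{nminval}(\sigma)}v_2^{\mathrm{nrcdrise}(\sigma)}\prod_{i\ \text{fixed point of}\ \sigma} w_{\mathrm{psnest}(i,\sigma)}$$ in the indeterminates $x_1,x_2,\widetilde{y}_1,y_2,u_1,u_2,\widetilde{v}_1,v_2$ and $\mathbf{w}=(w_k)_{k\ge0}$. Then, as formal power series in $t$, $$\sum_{n\ge0}\widetilde{Q}_n\,t^n=\cfrac{1}{1-\gamma_0t-\cfrac{\beta_1t^2}{1-\gamma_1t-\cfrac{\beta_2t^2}{1-\gamma_2t-\cdots}}}$$ with $\gamma_0=w_0$, $\gamma_n=[x_2+(n-1)u_2]+[y_2+(n-1)v_2]+w_n$ for $n\ge1$, and $\beta_n=[x_1+(n-1)u_1]\,[\widetilde{y}_1+(n-1)\widetilde{v}_1]$ for $n\ge1$.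
   Context: $\mathfrak{S}_n$ is the set of permutations of $[n]=\{1,\dots,n\}$. For $\sigma\in\mathfrak{S}_n$ and $i\in[n]$: $i$ is a cycle peak if $\sigma^{-1}(i)<i>\sigma(i)$, a cycle valley if $\sigma^{-1}(i)>i<\sigma(i)$, a cycle double rise if $\sigma^{-1}(i)<i<\sigma(i)$, a cycle double fall if $\sigma^{-1}(i)>i>\sigma(i)$, and a fixed point if $\sigma(i)=i$. An index $i$ is a record if $\sigma(j)<\sigma(i)$ for all $j<i$, and an antirecord if $\sigma(j)>\sigma(i)$ for all $j>i$; an exclusive record is a record that is not an antirecord, an exclusive antirecord is an antirecord that is not a record, and a neither-record-antirecord is an index that is neither. Statistics: eareccpeak = number of cycle peaks that are exclusive antirecords; eareccdfall = number of cycle double falls that are exclusive antirecords; ereccdrise = number of cycle double rises that are exclusive records; nrcpeak, nrcdfall, nrcdrise = numbers of cycle peaks, cycle double falls, cycle double rises (respectively) that are neither-record-antirecords; minval = number of cycle valleys that are the smallest element of their cycle; nminval = number of cycle valleys that are not the smallest element of their cycle. For a fixed point $i$, $\mathrm{psnest}(i,\sigma)=\#\{j<i:\sigma(j)>i\}$. *)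

theory Defs
  imports
    "HOL-Combinatorics.Combinatorics"
    "HOL-Computational_Algebra.Formal_Power_Series"
begin

text \<open>
  A permutation of \<open>{1..n}\<close> is a function \<open>\<sigma> :: nat \<Rightarrow> nat\<close> with \<open>\<sigma> permutes {1..n}\<close>; it is the
  identity outside \<open>{1..n}\<close>, so the index bounds below must be kept explicit.
\<close>

definition cpeak :: "(nat \<Rightarrow> nat) \<Rightarrow> nat \<Rightarrow> bool" where
  "cpeak \<sigma> i \<longleftrightarrow> inv \<sigma> i < i \<and> i > \<sigma> i"

definition cval :: "(nat \<Rightarrow> nat) \<Rightarrow> nat \<Rightarrow> bool" where
  "cval \<sigma> i \<longleftrightarrow> inv \<sigma> i > i \<and> i < \<sigma> i"

definition cdrise :: "(nat \<Rightarrow> nat) \<Rightarrow> nat \<Rightarrow> bool" where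
  "cdrise \<sigma> i \<longleftrightarrow> inv \<sigma> i < i \<and> i < \<sigma> i"

definition cdfall :: "(nat \<Rightarrow> nat) \<Rightarrow> nat \<Rightarrow> bool" where
  "cdfall \<sigma> i \<longleftrightarrow> inv \<sigma> i > i \<and> i > \<sigma> i"

definition is_record :: "nat \<Rightarrow> (nat \<Rightarrow> nat) \<Rightarrow> nat \<Rightarrow> bool" where
  "is_record n \<sigma> i \<longleftrightarrow> (\<forall>j\<in>{1..n}. j < i \<longrightarrow> \<sigma> j < \<sigma> i)"

definition is_antirecord :: "nat \<Rightarrow> (nat \<Rightarrow> nat) \<Rightarrow> nat \<Rightarrow> bool" where
  "is_antirecord n \<sigma> i \<longleftrightarrow> (\<forall>j\<in>{1..n}. j > i \<longrightarrow> \<sigma> j > \<sigma> i)"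

definition exrecord :: "nat \<Rightarrow> (nat \<Rightarrow> nat) \<Rightarrow> nat \<Rightarrow> bool" where
  "exrecord n \<sigma> i \<longleftrightarrow> is_record n \<sigma> i \<and> \<not> is_antirecord n \<sigma> i"

definition exantirecord :: "nat \<Rightarrow> (nat \<Rightarrow> nat) \<Rightarrow> nat \<Rightarrow> bool" where
  "exantirecord n \<sigma> i \<longleftrightarrow> is_antirecord n \<sigma> i \<and> \<not> is_record n \<sigma> i"

definition nrar :: "nat \<Rightarrow> (nat \<Rightarrow> nat) \<Rightarrow> nat \<Rightarrow> bool" where
  "nrar n \<sigma> i \<longleftrightarrow> \<not> is_record n \<sigma> i \<and> \<not> is_antirecord n \<sigma> i"

text \<open>For a permutation of a finite set, \<open>orbit \<sigma> i\<close> is the cycle of \<open>\<sigma>\<close> through \<open>i\<close>, including \<open>i\<close>.\<close>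

definition cycle_min :: "(nat \<Rightarrow> nat) \<Rightarrow> nat \<Rightarrow> bool" where
  "cycle_min \<sigma> i \<longleftrightarrow> (\<forall>j\<in>orbit \<sigma> i. i \<le> j)"

definition eareccpeak :: "nat \<Rightarrow> (nat \<Rightarrow> nat) \<Rightarrow> nat" where
  "eareccpeak n \<sigma> = card {i\<in>{1..n}. cpeak \<sigma> i \<and> exantirecord n \<sigma> i}"

definition eareccdfall :: "nat \<Rightarrow> (nat \<Rightarrow> nat) \<Rightarrow> nat" where
  "eareccdfall n \<sigma> = card {i\<in>{1..n}. cdfall \<sigma> i \<and> exantirecord n \<sigma> i}"

definition ereccdrise :: "nat \<Rightarrow> (nat \<Rightarrow> nat) \<Rightarrow> nat" where
  "ereccdrise n \<sigma> = card {i\<in>{1..n}. cdrise \<sigma> i \<and> exrecord n \<sigma> i}"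

definition nrcpeak :: "nat \<Rightarrow> (nat \<Rightarrow> nat) \<Rightarrow> nat" where
  "nrcpeak n \<sigma> = card {i\<in>{1..n}. cpeak \<sigma> i \<and> nrar n \<sigma> i}"

definition nrcdfall :: "nat \<Rightarrow> (nat \<Rightarrow> nat) \<Rightarrow> nat" where
  "nrcdfall n \<sigma> = card {i\<in>{1..n}. cdfall \<sigma> i \<and> nrar n \<sigma> i}"

definition nrcdrise :: "nat \<Rightarrow> (nat \<Rightarrow> nat) \<Rightarrow> nat" where
  "nrcdrise n \<sigma> = card {i\<in>{1..n}. cdrise \<sigma> i \<and> nrar n \<sigma> i}"

definition minval :: "nat \<Rightarrow> (nat \<Rightarrow> nat) \<Rightarrow> nat" where
  "minval n \<sigma> = card {i\<in>{1..n}. cval \<sigma> i \<and> cycle_min \<sigma> i}"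

definition nminval :: "nat \<Rightarrow> (nat \<Rightarrow> nat) \<Rightarrow> nat" where
  "nminval n \<sigma> = card {i\<in>{1..n}. cval \<sigma> i \<and> \<not> cycle_min \<sigma> i}"

definition psnest :: "nat \<Rightarrow> nat \<Rightarrow> (nat \<Rightarrow> nat) \<Rightarrow> nat" where
  "psnest n i \<sigma> = card {j\<in>{1..n}. j < i \<and> \<sigma> j > i}"

text \<open>
  The indeterminates are rendered as arbitrary elements of an arbitrary commutative ring; taking
  the ring to be the polynomial ring over the integers and the elements to be its generators gives
  the identity between formal polynomials.
\<close>

definition Qtilde ::
  "nat \<Rightarrow> 'a \<Rightarrow> 'a \<Rightarrow> 'a \<Rightarrow> 'a \<Rightarrow> 'a \<Rightarrow> 'a \<Rightarrow> 'a \<Rightarrow> 'a \<Rightarrow> (nat \<Rightarrow> 'a) \<Rightarrow> 'a::comm_ring_1" where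
  "Qtilde n x1 x2 y1 y2 u1 u2 v1 v2 w =
     (\<Sum>\<sigma> | \<sigma> permutes {1..n}.
        x1 ^ eareccpeak n \<sigma> * x2 ^ eareccdfall n \<sigma> *
        y1 ^ minval n \<sigma> * y2 ^ ereccdrise n \<sigma> *
        u1 ^ nrcpeak n \<sigma> * u2 ^ nrcdfall n \<sigma> *
        v1 ^ nminval n \<sigma> * v2 ^ nrcdrise n \<sigma> *
        (\<Prod>i | i \<in> {1..n} \<and> \<sigma> i = i. w (psnest n i \<sigma>)))"

text \<open>
  \<open>Jfrac_convergent \<gamma> \<beta> m k\<close> is the finite continued fraction with levels \<open>m, \<dots>, m + k\<close>,
  \[1/(1 - \gamma_m t - \beta_{m+1} t^2/(1 - \gamma_{m+1} t - \cdots - \beta_{m+k} t^2/(1 - \gamma_{m+k} t))).\]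
  Over a commutative ring without division, the reciprocal of a power series with constant
  coefficient 1 is \<open>fps_right_inverse _ 1\<close>. The value \<open>\<beta> 0\<close> is never used.
\<close>

fun Jfrac_convergent ::
  "(nat \<Rightarrow> 'a) \<Rightarrow> (nat \<Rightarrow> 'a) \<Rightarrow> nat \<Rightarrow> nat \<Rightarrow> 'a::comm_ring_1 fps" where
  "Jfrac_convergent \<gamma> \<beta> m 0 =
     fps_right_inverse (1 - fps_const (\<gamma> m) * fps_X) 1"
| "Jfrac_convergent \<gamma> \<beta> m (Suc k) =
     fps_right_inverse
       (1 - fps_const (\<gamma> m) * fps_X
          - fps_const (\<beta> (Suc m)) * fps_X ^ 2 * Jfrac_convergent \<gamma> \<beta> (Suc m) k) 1"

lemma Jfrac_convergent_0_reciprocal: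
  "(1 - fps_const (\<gamma> m) * fps_X) * Jfrac_convergent \<gamma> \<beta> m 0 = 1"
  unfolding Jfrac_convergent.simps by (rule fps_right_inverse) simp

lemma Jfrac_convergent_Suc_reciprocal:
  "(1 - fps_const (\<gamma> m) * fps_X
      - fps_const (\<beta> (Suc m)) * fps_X ^ 2 * Jfrac_convergent \<gamma> \<beta> (Suc m) k)
   * Jfrac_convergent \<gamma> \<beta> m (Suc k) = 1"
  unfolding Jfrac_convergent.simps by (rule fps_right_inverse) (simp add: power2_eq_square)

text \<open>
  The infinite continued fraction is the limit of its convergents in the \<open>t\<close>-adic topology, which
  is the topology of the metric on \<open>'a fps\<close>.
\<close>

definition has_Jfrac :: "'a::comm_ring_1 fps \<Rightarrow> (nat \<Rightarrow> 'a) \<Rightarrow> (nat \<Rightarrow> 'a) \<Rightarrow> bool" where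
  "has_Jfrac F \<gamma> \<beta> \<longleftrightarrow> (\<lambda>k. Jfrac_convergent \<gamma> \<beta> 0 k) \<longlonglongrightarrow> F"

end

theory Submission
  imports Defs
begin

text \<open>
  Sort the permutations by the word recording the cycle type of each index. Reading valleys as up
  steps, cycle peaks as down steps and all other types as level steps, the word is a Motzkin path,
  and the number of \<open>j \<le> i\<close> with \<open>\<sigma> j > i\<close> is its height after \<open>i\<close> steps.

  For a fixed word, first place the anti-excedances by increasing position. At height \<open>h\<close> there are
  \<open>h\<close> values to choose from, and the index becomes an antirecord exactly for the smallest one. Then
  place the excedances by decreasing position. Again the number of available values is the height;
  a double rise becomes a record exactly for the largest one, and a valley becomes the minimum of its
  cycle exactly for the one value that closes a cycle. So the permutations with a given word have
  total weight equal to the product of the step weights, and Flajolet's theorem on Motzkin paths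
  gives the continued fraction.
\<close>

section \<open>Continued fractions and Motzkin paths\<close>

lemma fps_X_power_dvd_imp_nth_eq:
  fixes f g :: "'a::comm_ring_1 fps"
  assumes "fps_X ^ N dvd f - g" and "j < N"
  shows "fps_nth f j = fps_nth g j"
proof -
  obtain h where h: "f - g = fps_X ^ N * h"
    using assms(1) by (auto simp: dvd_def)
  have "fps_nth (f - g) j = 0"
    unfolding h using assms(2) by (simp add: fps_X_power_mult_nth)
  thus ?thesis by simp
qed

text \<open>Euler's method: dividing the recurrence by \<open>G (Suc m)\<close> expresses the ratio
  \<open>G (Suc m) / G m\<close> through the next ratio, and iterating unrolls the continued
  fraction. The claim is multiplied out into a divisibility because the \<open>G m\<close> may fail
  to be invertible. Each level multiplies the error by \<open>fps_X ^ 2\<close>, more than the one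
  factor claimed.\<close>

lemma Jfrac_convergent_Euler:
  fixes G :: "nat \<Rightarrow> 'a::comm_ring_1 fps"
  assumes rec: "\<And>m. G m = (1 - fps_const (\<gamma> m) * fps_X) * G (Suc m)
      - fps_const (\<beta> (Suc m)) * fps_X ^ 2 * G (Suc (Suc m))"
  shows "fps_X ^ Suc k dvd Jfrac_convergent \<gamma> \<beta> m k * G m - G (Suc m)"
proof (induction k arbitrary: m)
  case 0
  let ?J = "Jfrac_convergent \<gamma> \<beta> m 0" and ?B = "fps_const (\<beta> (Suc m))"
  have "?J * G m = ((1 - fps_const (\<gamma> m) * fps_X) * ?J) * G (Suc m)
      - ?J * ?B * fps_X ^ 2 * G (Suc (Suc m))"
    by (subst rec) (simp add: algebra_simps)
  hence "?J * G m - G (Suc m) = fps_X * (- ?J * ?B * fps_X * G (Suc (Suc m)))"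
    unfolding Jfrac_convergent_0_reciprocal by (simp add: algebra_simps power2_eq_square)
  thus ?case by (metis dvd_triv_left power_one_right One_nat_def)
next
  case (Suc k)
  let ?J = "Jfrac_convergent \<gamma> \<beta> m (Suc k)" and ?J' = "Jfrac_convergent \<gamma> \<beta> (Suc m) k"
  let ?B = "fps_const (\<beta> (Suc m))"
  obtain E where E: "?J' * G (Suc m) - G (Suc (Suc m)) = fps_X ^ Suc k * E"
    using Suc.IH[of "Suc m"] by (auto simp: dvd_def)
  have G2: "G (Suc (Suc m)) = ?J' * G (Suc m) - fps_X ^ Suc k * E"
    unfolding E[symmetric] by simp
  \<comment> \<open>Trading \<open>G (Suc (Suc m))\<close> for its approximation turns the
    coefficient of \<open>G (Suc m)\<close> into \<open>?J\<close> times its reciprocal, which is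
    1.\<close>
  have "?J * G m = ((1 - fps_const (\<gamma> m) * fps_X - ?B * fps_X ^ 2 * ?J') * ?J) * G (Suc m)
      + ?J * ?B * fps_X ^ 2 * (fps_X ^ Suc k * E)"
    by (subst rec, subst G2) (simp only: algebra_simps)
  hence "?J * G m - G (Suc m) = fps_X ^ Suc (Suc k) * (?J * ?B * fps_X * E)"
    unfolding Jfrac_convergent_Suc_reciprocal by (simp add: algebra_simps power2_eq_square)
  thus ?case by (metis dvd_triv_left)
qed

text \<open>As \<open>G 0 = 1\<close>, the divisibility at \<open>m = 0\<close> compares the
  convergents with \<open>G 1\<close> itself, so coefficient \<open>j\<close> is final from
  \<open>k = j\<close> on.\<close>

lemma has_Jfrac_Euler:
  fixes G :: "nat \<Rightarrow> 'a::comm_ring_1 fps"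
  assumes "\<And>m. G m = (1 - fps_const (\<gamma> m) * fps_X) * G (Suc m)
      - fps_const (\<beta> (Suc m)) * fps_X ^ 2 * G (Suc (Suc m))"
    and "G 0 = 1"
  shows "has_Jfrac (G 1) \<gamma> \<beta>"
  unfolding has_Jfrac_def
proof (rule tendsto_fpsI)
  fix j
  have "fps_nth (Jfrac_convergent \<gamma> \<beta> 0 k) j = fps_nth (G 1) j" if "k \<ge> j" for k
    using Jfrac_convergent_Euler[of G \<gamma> \<beta> k 0, OF assms(1)] assms(2) that
    by (intro fps_X_power_dvd_imp_nth_eq[of "Suc k"]) auto
  thus "\<forall>\<^sub>F k in sequentially. fps_nth (Jfrac_convergent \<gamma> \<beta> 0 k) j = fps_nth (G 1) j"
    by (auto simp: eventually_sequentially)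
qed

text \<open>The weighted count of Motzkin paths with \<open>n\<close> steps from height
  \<open>h\<close> to 0, by first step. Down steps weigh 1; an up step from \<open>h\<close> carries
  the whole of \<open>\<beta> (Suc h)\<close>.\<close>

fun motzkin_sum :: "(nat \<Rightarrow> 'a) \<Rightarrow> (nat \<Rightarrow> 'a) \<Rightarrow> nat \<Rightarrow> nat \<Rightarrow> 'a::comm_ring_1" where
  "motzkin_sum \<gamma> \<beta> 0 h = (if h = 0 then 1 else 0)"
| "motzkin_sum \<gamma> \<beta> (Suc n) h = (if h = 0 then 0 else motzkin_sum \<gamma> \<beta> n (h - 1))
     + \<gamma> h * motzkin_sum \<gamma> \<beta> n h + \<beta> (Suc h) * motzkin_sum \<gamma> \<beta> n (Suc h)"

lemma motzkin_sum_eq_0: "n < h \<Longrightarrow> motzkin_sum \<gamma> \<beta> n h = 0"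
  by (induction n arbitrary: h) auto

text \<open>A path from height \<open>h\<close> to 0 has at least \<open>h\<close> steps, and
  \<open>G (Suc h)\<close> is the generating function of these paths with that power of
  \<open>fps_X\<close> removed. Splitting off the first step is then Euler's recurrence.\<close>

lemma has_Jfrac_motzkin_sum: "has_Jfrac (Abs_fps (\<lambda>n. motzkin_sum \<gamma> \<beta> n 0)) \<gamma> \<beta>"
proof -
  let ?N = "motzkin_sum \<gamma> \<beta>"
  define G where
    "G m = (case m of 0 \<Rightarrow> 1 | Suc h \<Rightarrow> Abs_fps (\<lambda>n. ?N (n + h) h))" for m
  have nth_G: "fps_nth (G (Suc h)) n = ?N (n + h) h" for h n
    by (simp add: G_def)
  have "G m = (1 - fps_const (\<gamma> m) * fps_X) * G (Suc m)
      - fps_const (\<beta> (Suc m)) * fps_X ^ 2 * G (Suc (Suc m))" (is "_ = ?R") for m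
  proof (rule fps_ext)
    fix j
    have R: "fps_nth ?R j = ?N (j + m) m
        - \<gamma> m * (if j = 0 then 0 else ?N (j - 1 + m) m)
        - \<beta> (Suc m) * (if j < 2 then 0 else ?N (j - 2 + Suc m) (Suc m))"
      by (simp add: left_diff_distrib mult.assoc fps_X_power_mult_nth nth_G)
    show "fps_nth (G m) j = fps_nth ?R j"
    proof (cases m)
      case 0
      show ?thesis
      proof (cases j)
        case (Suc i)
        thus ?thesis unfolding R
          by (cases i) (simp_all add: 0 G_def motzkin_sum_eq_0)
      qed (simp add: R 0 G_def)
    next
      case (Suc h)
      hence Gm: "fps_nth (G m) j = ?N (j + h) h" by (simp add: nth_G)
      \<comment> \<open>For \<open>j < 2\<close> a factor \<open>fps_X\<close> or
        \<open>fps_X ^ 2\<close> removes a term; the matching path sum is 0 because too few steps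
        remain to come down.\<close>
      consider "j = 0" | "j = 1" | i where "j = Suc (Suc i)"
        by (metis One_nat_def not0_implies_Suc)
      thus ?thesis unfolding R Gm
        by cases (simp_all add: Suc motzkin_sum_eq_0)
    qed
  qed
  moreover have "G 0 = 1" by (simp add: G_def)
  ultimately have "has_Jfrac (G 1) \<gamma> \<beta>" by (rule has_Jfrac_Euler)
  thus ?thesis by (simp add: G_def)
qed

section \<open>Permutations with a given word of cycle types\<close>

datatype cycle_type = Peak | Valley | Rise | Fall | Fix

lemma UNIV_cycle_type: "UNIV = {Peak, Valley, Rise, Fall, Fix}"
  using cycle_type.exhaust by blast

instance cycle_type :: finite
  by standard (simp add: UNIV_cycle_type)

definition cycle_type_of :: "(nat \<Rightarrow> nat) \<Rightarrow> nat \<Rightarrow> cycle_type" where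
  "cycle_type_of \<sigma> i =
     (if \<sigma> i = i then Fix
      else if inv \<sigma> i < i then (if \<sigma> i < i then Peak else Rise)
      else (if \<sigma> i < i then Fall else Valley))"

text \<open>The bracket \<open>a + (h - 1) b\<close> of the theorem, set to 0 at height 0, where
  there is nothing to choose.\<close>

definition level_weight :: "'a \<Rightarrow> 'a \<Rightarrow> nat \<Rightarrow> 'a::comm_ring_1" where
  "level_weight a b h = (if h = 0 then 0 else a + of_nat (h - 1) * b)"

text \<open>Membership of \<open>t\<close> is asked only for nonempty \<open>Opts\<close>, so that
  \<open>t\<close> may be given as \<open>Min Opts\<close> or \<open>Max Opts\<close>.\<close>

lemma sum_distinguished_choice:
  fixes a b :: "'a::comm_ring_1"
  assumes "finite Opts" and "Opts \<noteq> {} \<Longrightarrow> t \<in> Opts"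
  shows "(\<Sum>v\<in>Opts. if v = t then a else b) = level_weight a b (card Opts)"
proof (cases "Opts = {}")
  case False
  hence t: "t \<in> Opts" using assms(2) by blast
  have "(\<Sum>v\<in>Opts. if v = t then a else b) = a + (\<Sum>v\<in>Opts - {t}. if v = t then a else b)"
    using assms(1) t by (simp add: sum.remove)
  also have "(\<Sum>v\<in>Opts - {t}. if v = t then a else b) = (\<Sum>v\<in>Opts - {t}. b)"
    by (rule sum.cong) auto
  finally show ?thesis
    using assms(1) t False by (simp add: level_weight_def card_gt_0_iff)
qed (simp add: level_weight_def)

text \<open>
  The functions of \<open>S\<close> are built up by assigning values at the positions \<open>rs\<close> one after the other;
  \<open>P rs f\<close> says that \<open>f\<close> is an admissible partial assignment when the positions \<open>rs\<close> remain.
\<close>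

lemma sum_prod_successive_choices:
  fixes S :: "('i \<Rightarrow> 'v) set" and wt :: "('i \<Rightarrow> 'v) \<Rightarrow> 'i \<Rightarrow> 'a::comm_ring_1"
  assumes "finite S"
    and distinct: "\<And>rs f. P rs f \<Longrightarrow> distinct rs"
    and complete: "\<And>f. P [] f \<Longrightarrow> f \<in> S"
    and step: "\<And>p rs f. P (p # rs) f \<Longrightarrow>
      \<exists>Opts \<omega>. finite Opts \<and> (\<forall>v\<in>Opts. P rs (f(p := v))) \<and> (\<Sum>v\<in>Opts. \<omega> v) = c p \<and>
        (\<forall>\<sigma>\<in>S. (\<forall>i. i \<notin> set (p # rs) \<longrightarrow> \<sigma> i = f i) \<longrightarrow> \<sigma> p \<in> Opts \<and> wt \<sigma> p = \<omega> (\<sigma> p))"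
    and "P rs f"
  shows "(\<Sum>\<sigma> | \<sigma> \<in> S \<and> (\<forall>i. i \<notin> set rs \<longrightarrow> \<sigma> i = f i). \<Prod>p\<in>set rs. wt \<sigma> p) = (\<Prod>p\<in>set rs. c p)"
  using \<open>P rs f\<close>
proof (induction rs arbitrary: f)
  case Nil
  hence "{\<sigma>. \<sigma> \<in> S \<and> (\<forall>i. i \<notin> set [] \<longrightarrow> \<sigma> i = f i)} = {f}"
    using complete by auto
  thus ?case by simp
next
  case (Cons p rs)
  let ?E = "\<lambda>rs f. {\<sigma>. \<sigma> \<in> S \<and> (\<forall>i. i \<notin> set rs \<longrightarrow> \<sigma> i = f i)}"
  have p: "p \<notin> set rs" using distinct[OF Cons.prems] by simp
  obtain Opts \<omega> where Opts: "finite Opts" "\<And>v. v \<in> Opts \<Longrightarrow> P rs (f(p := v))"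
    "(\<Sum>v\<in>Opts. \<omega> v) = c p"
    "\<And>\<sigma>. \<sigma> \<in> ?E (p # rs) f \<Longrightarrow> \<sigma> p \<in> Opts \<and> wt \<sigma> p = \<omega> (\<sigma> p)"
    using step[OF Cons.prems] by blast
  have fin: "finite (?E (p # rs) f)" using \<open>finite S\<close> by simp
  have sub: "(\<lambda>\<sigma>. \<sigma> p) ` ?E (p # rs) f \<subseteq> Opts" using Opts(4) by blast
  have fibre: "{\<sigma> \<in> ?E (p # rs) f. \<sigma> p = v} = ?E rs (f(p := v))" for v
    using p by auto
  have "(\<Sum>\<sigma>\<in>?E (p # rs) f. \<Prod>q\<in>set (p # rs). wt \<sigma> q)
      = (\<Sum>v\<in>Opts. \<Sum>\<sigma>\<in>?E rs (f(p := v)). \<Prod>q\<in>set (p # rs). wt \<sigma> q)"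
    unfolding fibre[symmetric] by (rule sum.group[symmetric, OF fin Opts(1) sub])
  also have "\<dots> = (\<Sum>v\<in>Opts. \<omega> v * (\<Prod>q\<in>set rs. c q))"
  proof (rule sum.cong[OF refl])
    fix v assume v: "v \<in> Opts"
    have "(\<Sum>\<sigma>\<in>?E rs (f(p := v)). \<Prod>q\<in>set (p # rs). wt \<sigma> q)
        = (\<Sum>\<sigma>\<in>?E rs (f(p := v)). \<omega> v * (\<Prod>q\<in>set rs. wt \<sigma> q))"
    proof (rule sum.cong[OF refl])
      fix \<sigma> assume "\<sigma> \<in> ?E rs (f(p := v))"
      hence "\<sigma> \<in> ?E (p # rs) f" "\<sigma> p = v" using fibre[of v] by blast+
      thus "(\<Prod>q\<in>set (p # rs). wt \<sigma> q) = \<omega> v * (\<Prod>q\<in>set rs. wt \<sigma> q)"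
        using p Opts(4) by simp
    qed
    also have "\<dots> = \<omega> v * (\<Prod>q\<in>set rs. c q)"
      using Cons.IH[OF Opts(2)[OF v]] by (simp add: sum_distrib_left[symmetric])
    finally show "(\<Sum>\<sigma>\<in>?E rs (f(p := v)). \<Prod>q\<in>set (p # rs). wt \<sigma> q) = \<omega> v * (\<Prod>q\<in>set rs. c q)" .
  qed
  also have "\<dots> = (\<Prod>q\<in>set (p # rs). c q)"
    using p Opts(3) by (simp add: sum_distrib_right[symmetric])
  finally show ?case .
qed

text \<open>Pigeonhole: a record at \<open>i\<close> would send the \<open>i - 1\<close> smaller
  indices injectively to values below \<open>\<sigma> i\<close>, of which there are fewer.\<close>

lemma permutes_below_not_record:
  assumes \<sigma>: "\<sigma> permutes {1..n}" and i: "i \<in> {1..n}" "\<sigma> i < i"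
  shows "\<not> is_record n \<sigma> i"
proof
  assume "is_record n \<sigma> i"
  hence "\<sigma> ` {1..<i} \<subseteq> {1..<\<sigma> i}"
    using i permutes_in_image[OF \<sigma>] by (fastforce simp: is_record_def)
  hence "card {1..<i} \<le> card {1..<\<sigma> i}"
    by (rule card_inj_on_le[OF inj_on_subset[OF permutes_inj[OF \<sigma>] subset_UNIV]]) simp
  moreover have "\<sigma> i \<ge> 1" using i permutes_in_image[OF \<sigma>, of i] by simp
  ultimately show False using i by simp
qed

lemma permutes_above_not_antirecord:
  assumes \<sigma>: "\<sigma> permutes {1..n}" and i: "i \<in> {1..n}" "\<sigma> i > i"
  shows "\<not> is_antirecord n \<sigma> i"
proof
  assume "is_antirecord n \<sigma> i"
  hence "\<sigma> ` {i<..n} \<subseteq> {\<sigma> i<..n}"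
    using i permutes_in_image[OF \<sigma>] by (fastforce simp: is_antirecord_def)
  hence "card {i<..n} \<le> card {\<sigma> i<..n}"
    by (rule card_inj_on_le[OF inj_on_subset[OF permutes_inj[OF \<sigma>] subset_UNIV]]) simp
  moreover have "\<sigma> i \<le> n" using i permutes_in_image[OF \<sigma>, of i] by simp
  ultimately show False using i by simp
qed

definition distinguished :: "nat \<Rightarrow> (nat \<Rightarrow> nat) \<Rightarrow> cycle_type \<Rightarrow> nat \<Rightarrow> bool" where
  "distinguished n \<sigma> t i =
     (case t of Peak \<Rightarrow> is_antirecord n \<sigma> i | Fall \<Rightarrow> is_antirecord n \<sigma> i
        | Rise \<Rightarrow> is_record n \<sigma> i | Valley \<Rightarrow> cycle_min \<sigma> i | Fix \<Rightarrow> False)"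

text \<open>Here \<open>h\<close> and \<open>h'\<close> are the heights before and after the step.
  An excedance chooses among the values open after its own step, an anti-excedance among those open
  before it.\<close>

definition step_weight ::
  "(cycle_type \<Rightarrow> 'a) \<Rightarrow> (cycle_type \<Rightarrow> 'a) \<Rightarrow> (nat \<Rightarrow> 'a) \<Rightarrow> cycle_type \<Rightarrow> nat \<Rightarrow> nat \<Rightarrow> 'a::comm_ring_1" where
  "step_weight a b w t h h' =
     (case t of Fix \<Rightarrow> w h | Peak \<Rightarrow> level_weight (a t) (b t) h | Fall \<Rightarrow> level_weight (a t) (b t) h
        | Rise \<Rightarrow> level_weight (a t) (b t) h' | Valley \<Rightarrow> level_weight (a t) (b t) h')"

definition index_weight ::
  "(cycle_type \<Rightarrow> 'a) \<Rightarrow> (cycle_type \<Rightarrow> 'a) \<Rightarrow> (nat \<Rightarrow> 'a) \<Rightarrow> nat \<Rightarrow> (nat \<Rightarrow> nat) \<Rightarrow> nat \<Rightarrow> 'a::comm_ring_1" where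
  "index_weight a b w n \<sigma> i =
     (let t = cycle_type_of \<sigma> i in
        if t = Fix then w (psnest n i \<sigma>) else if distinguished n \<sigma> t i then a t else b t)"

section \<open>Positions and values prescribed by a word of cycle types\<close>

locale cycle_type_word =
  fixes n :: nat and \<tau> :: "nat \<Rightarrow> cycle_type"
begin

text \<open>The type of an index compares it both with its image, which decides its role as a
  position, and with its preimage, which decides its role as a value. Hence \<open>Rise\<close> and
  \<open>Fall\<close> each occur in a position set and in the matching value set.\<close>

definition excs :: "nat set" where "excs = {i \<in> {1..n}. \<tau> i \<in> {Valley, Rise}}"
definition exc_values :: "nat set" where "exc_values = {i \<in> {1..n}. \<tau> i \<in> {Peak, Rise}}"
definition aexcs :: "nat set" where "aexcs = {i \<in> {1..n}. \<tau> i \<in> {Peak, Fall}}"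
definition aexc_values :: "nat set" where "aexc_values = {i \<in> {1..n}. \<tau> i \<in> {Valley, Fall}}"

lemmas position_sets = excs_def exc_values_def aexcs_def aexc_values_def

definition perms :: "(nat \<Rightarrow> nat) set" where
  "perms = {\<sigma>. \<sigma> permutes {1..n} \<and> (\<forall>i\<in>{1..n}. cycle_type_of \<sigma> i = \<tau> i)}"

definition height :: "nat \<Rightarrow> nat" where
  "height i = card {j \<in> {1..i}. \<tau> j = Valley} - card {j \<in> {1..i}. \<tau> j = Peak}"

text \<open>These conditions concern one position and its value at a time, so they make sense for
  partial assignments. For functions that are the identity outside \<open>{1..n}\<close>, imposing
  them on all of \<open>{1..n}\<close> describes \<open>perms\<close>, by \<open>permsD\<close> and
  \<open>permsI\<close>.\<close>

definition partial_perm :: "nat set \<Rightarrow> (nat \<Rightarrow> nat) \<Rightarrow> bool" where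
  "partial_perm A f \<longleftrightarrow> inj_on f A \<and>
     (\<forall>i\<in>A. (i \<in> excs \<longrightarrow> i < f i \<and> f i \<in> exc_values) \<and>
            (i \<in> aexcs \<longrightarrow> f i < i \<and> f i \<in> aexc_values) \<and>
            (i \<notin> excs \<longrightarrow> i \<notin> aexcs \<longrightarrow> f i = i))"

lemma position_sets_disjoint:
  "excs \<inter> aexcs = {}" "exc_values \<inter> aexc_values = {}"
  by (auto simp: position_sets)

lemma finite_position_sets [simp]:
  "finite excs" "finite exc_values" "finite aexcs" "finite aexc_values"
  by (simp_all add: position_sets)

lemma position_sets_subset:
  "i \<in> excs \<Longrightarrow> 1 \<le> i \<and> i \<le> n" "i \<in> exc_values \<Longrightarrow> 1 \<le> i \<and> i \<le> n"
  "i \<in> aexcs \<Longrightarrow> 1 \<le> i \<and> i \<le> n" "i \<in> aexc_values \<Longrightarrow> 1 \<le> i \<and> i \<le> n"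
  by (auto simp: position_sets)

lemma not_exc_iff:
  "i \<in> {1..n} \<Longrightarrow> i \<notin> excs \<and> i \<notin> aexcs \<longleftrightarrow> \<tau> i = Fix"
  "i \<in> {1..n} \<Longrightarrow> i \<notin> exc_values \<and> i \<notin> aexc_values \<longleftrightarrow> \<tau> i = Fix"
  by (cases "\<tau> i"; simp add: position_sets)+

lemma permsD:
  assumes "\<sigma> \<in> perms"
  shows "\<sigma> permutes {1..n}" "inj \<sigma>" "partial_perm {1..n} \<sigma>"
proof -
  show \<sigma>: "\<sigma> permutes {1..n}" using assms by (simp add: perms_def)
  show inj: "inj \<sigma>" by (rule permutes_inj[OF \<sigma>])
  have ty: "cycle_type_of \<sigma> i = \<tau> i" if "i \<in> {1..n}" for i
    using assms that by (simp add: perms_def)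
  have inv: "inv \<sigma> (\<sigma> i) = i" for i using inj by simp
  have "(i \<in> excs \<longrightarrow> i < \<sigma> i \<and> \<sigma> i \<in> exc_values) \<and>
        (i \<in> aexcs \<longrightarrow> \<sigma> i < i \<and> \<sigma> i \<in> aexc_values) \<and>
        (i \<notin> excs \<longrightarrow> i \<notin> aexcs \<longrightarrow> \<sigma> i = i)" if i: "i \<in> {1..n}" for i
  proof -
    have \<sigma>i: "\<sigma> i \<in> {1..n}" using i permutes_in_image[OF \<sigma>] by simp
    have ty1: "\<tau> i = cycle_type_of \<sigma> i" and ty2: "\<tau> (\<sigma> i) = cycle_type_of \<sigma> (\<sigma> i)"
      using ty i \<sigma>i by auto
    have "i \<in> excs \<longleftrightarrow> i < \<sigma> i"
      using i by (auto simp: excs_def ty1 cycle_type_of_def)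
    moreover have "i \<in> aexcs \<longleftrightarrow> \<sigma> i < i"
      using i by (auto simp: aexcs_def ty1 cycle_type_of_def)
    \<comment> \<open>If \<open>i\<close> is moved, so is \<open>\<sigma> i\<close>; the type of
      \<open>\<sigma> i\<close> then shows on which side its preimage \<open>i\<close> lies.\<close>
    moreover have "\<sigma> (\<sigma> i) = \<sigma> i \<longleftrightarrow> \<sigma> i = i" using inj by (simp add: inj_eq)
    hence "i < \<sigma> i \<Longrightarrow> \<sigma> i \<in> exc_values" "\<sigma> i < i \<Longrightarrow> \<sigma> i \<in> aexc_values"
      using \<sigma>i by (auto simp: exc_values_def aexc_values_def ty2 cycle_type_of_def inv)
    ultimately show ?thesis by auto
  qed
  thus "partial_perm {1..n} \<sigma>"
    unfolding partial_perm_def using inj_on_subset[OF inj subset_UNIV] by blast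
qed

text \<open>An injective map of a finite set into itself is a permutation. The condition at
  \<open>i\<close> locates \<open>f i\<close> and the condition at the preimage of \<open>i\<close>
  locates that preimage, which together fix the type.\<close>

lemma permsI:
  assumes f: "partial_perm {1..n} f" and id: "\<And>i. i \<notin> {1..n} \<Longrightarrow> f i = i"
  shows "f \<in> perms"
proof -
  have maps: "f i \<in> {1..n}" if "i \<in> {1..n}" for i
    using f that position_sets_subset unfolding partial_perm_def by (metis atLeastAtMost_iff)
  have "bij_betw f {1..n} {1..n}"
    using f maps endo_inj_surj[of "{1..n}" f] unfolding bij_betw_def partial_perm_def by blast
  hence perm: "f permutes {1..n}" using id by (rule bij_imp_permutes)
  have inj: "inj f" by (rule permutes_inj[OF perm])
  have "cycle_type_of f i = \<tau> i" if i: "i \<in> {1..n}" for i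
  proof -
    define k where "k = inv f i"
    have fk: "f k = i" using permutes_inverses[OF perm] by (simp add: k_def)
    have k: "k \<in> {1..n}" using i permutes_in_image[OF perm, of k] fk by simp
    note P = f[unfolded partial_perm_def, THEN conjunct2, rule_format]
    have Pk: "(k \<in> excs \<and> k < i \<and> i \<in> exc_values) \<or> (k \<in> aexcs \<and> i < k \<and> i \<in> aexc_values)
        \<or> (k = i \<and> \<tau> i = Fix)"
      using P[OF k] fk not_exc_iff(1)[OF k] by auto
    show ?thesis
      using P[OF i] Pk fk i unfolding cycle_type_of_def k_def[symmetric] position_sets
      by (cases "\<tau> i") auto
  qed
  thus ?thesis using perm by (simp add: perms_def)
qed

lemma perms_preimage:
  assumes "\<sigma> \<in> perms"
  shows "v \<in> exc_values \<Longrightarrow> inv \<sigma> v \<in> excs \<and> inv \<sigma> v < v"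
    and "v \<in> aexc_values \<Longrightarrow> inv \<sigma> v \<in> aexcs \<and> v < inv \<sigma> v"
    and "\<sigma> (inv \<sigma> v) = v"
proof -
  note \<sigma> = permsD[OF assms]
  show eq: "\<sigma> (inv \<sigma> v) = v" using permutes_inverses[OF \<sigma>(1)] by simp
  have P: "(inv \<sigma> v \<in> excs \<and> inv \<sigma> v < v \<and> v \<in> exc_values)
      \<or> (inv \<sigma> v \<in> aexcs \<and> v < inv \<sigma> v \<and> v \<in> aexc_values) \<or> \<tau> v = Fix" if v: "v \<in> {1..n}"
  proof -
    have k: "inv \<sigma> v \<in> {1..n}"
      using v permutes_in_image[OF \<sigma>(1), of "inv \<sigma> v"] eq by simp
    show ?thesis
      using \<sigma>(3) k eq not_exc_iff(1)[OF k] unfolding partial_perm_def by fastforce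
  qed
  show "v \<in> exc_values \<Longrightarrow> inv \<sigma> v \<in> excs \<and> inv \<sigma> v < v"
    using P by (auto simp: exc_values_def aexc_values_def)
  show "v \<in> aexc_values \<Longrightarrow> inv \<sigma> v \<in> aexcs \<and> v < inv \<sigma> v"
    using P by (auto simp: exc_values_def aexc_values_def)
qed

text \<open>When positions and values are compared, this makes the shared type \<open>Rise\<close>
  or \<open>Fall\<close> cancel, leaving only valleys and peaks.\<close>

lemma card_two_types:
  assumes "finite A" "s \<noteq> t"
  shows "card {i \<in> A. \<tau> i \<in> {s, t}} = card {i \<in> A. \<tau> i = s} + card {i \<in> A. \<tau> i = t}"
proof -
  have "{i \<in> A. \<tau> i \<in> {s, t}} = {i \<in> A. \<tau> i = s} \<union> {i \<in> A. \<tau> i = t}" by auto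
  thus ?thesis using assms by (auto simp: card_Un_disjoint disjoint_iff)
qed

text \<open>A permutation maps excedance positions bijectively onto excedance values, and the rises
  cancel.\<close>

lemma perms_balanced:
  assumes "\<sigma> \<in> perms"
  shows "card {j \<in> {1..n}. \<tau> j = Valley} = card {j \<in> {1..n}. \<tau> j = Peak}"
proof -
  have "\<sigma> ` excs = exc_values"
    using permsD(3)[OF assms] perms_preimage(1,3)[OF assms] position_sets_subset(1)
    unfolding partial_perm_def by (fastforce simp: image_iff)
  hence "card excs = card exc_values"
    using card_image[OF inj_on_subset[OF permsD(2)[OF assms] subset_UNIV]] by metis
  thus ?thesis unfolding excs_def exc_values_def by (simp only: card_two_types finite_atLeastAtMost
    cycle_type.distinct not_False_eq_True add_right_cancel)
qed

text \<open>The indices counted are the excedances below \<open>p\<close> whose value is not below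
  \<open>p\<close>. Each excedance value below \<open>p\<close> uses up one excedance position below
  \<open>p\<close>, so their number is a difference of two counts.\<close>

lemma psnest_eq_height:
  assumes \<sigma>: "\<sigma> \<in> perms" and p: "p \<in> {1..n}" "\<tau> p = Fix"
  shows "psnest n p \<sigma> = height (p - 1)"
proof -
  note P = permsD[OF \<sigma>]
  let ?I = "{1..p-1}"
  let ?E = "{j \<in> ?I. \<tau> j \<in> {Valley, Rise}}" and ?V = "{j \<in> ?I. \<tau> j \<in> {Peak, Rise}}"
  have E: "?E = {j \<in> excs. j < p}" and V: "?V = {j \<in> exc_values. j < p}"
    using p by (auto simp: position_sets)
  have fixed: "\<sigma> p = p"
    using P(3) p not_exc_iff(1)[OF p(1)] by (auto simp: partial_perm_def)
  have "{j \<in> {1..n}. j < p \<and> \<sigma> j > p} = ?E - inv \<sigma> ` ?V"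
  proof (intro equalityI subsetI)
    fix j assume j: "j \<in> {j \<in> {1..n}. j < p \<and> \<sigma> j > p}"
    hence "j \<in> excs" using P(3) unfolding partial_perm_def by fastforce
    moreover have "j \<notin> inv \<sigma> ` ?V" using j perms_preimage(3)[OF \<sigma>] unfolding V by fastforce
    ultimately show "j \<in> ?E - inv \<sigma> ` ?V" using j unfolding E by simp
  next
    fix j assume j: "j \<in> ?E - inv \<sigma> ` ?V"
    hence j': "j \<in> excs" "j < p" unfolding E by auto
    hence "\<sigma> j \<in> exc_values" using P(3) position_sets_subset(1)[of j] unfolding partial_perm_def by fastforce
    moreover have "inv \<sigma> (\<sigma> j) = j" using P(2) by simp
    ultimately have "\<not> \<sigma> j < p" using j unfolding V by (metis (mono_tags, lifting) DiffE image_eqI mem_Collect_eq)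
    moreover have "\<sigma> j \<noteq> p" using fixed j' P(2) by (metis inj_eq less_irrefl)
    ultimately show "j \<in> {j \<in> {1..n}. j < p \<and> \<sigma> j > p}"
      using j' position_sets_subset(1)[of j] by simp
  qed
  moreover have "inv \<sigma> ` ?V \<subseteq> ?E"
    unfolding E V using perms_preimage(1)[OF \<sigma>] by fastforce
  moreover have "card (inv \<sigma> ` ?V) = card ?V"
    by (rule card_image[OF inj_on_subset[OF permutes_inj[OF permutes_inv[OF P(1)]] subset_UNIV]])
  ultimately have "psnest n p \<sigma> = card ?E - card ?V"
    unfolding psnest_def by (simp add: card_Diff_subset)
  thus ?thesis unfolding height_def by (simp only: card_two_types finite_atLeastAtMost
    cycle_type.distinct not_False_eq_True add_diff_cancel_right)
qed

section \<open>The order of placement and the admissible partial assignments\<close>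

definition before :: "nat \<Rightarrow> nat \<Rightarrow> bool" where
  "before i j \<longleftrightarrow> i \<in> aexcs \<and> (j \<in> excs \<or> j \<in> aexcs \<and> i < j) \<or> i \<in> excs \<and> j \<in> excs \<and> j < i"

text \<open>The second and third conditions say that \<open>rs\<close> is a final segment of the
  order \<open>before\<close>. Fixed points and indices outside \<open>{1..n}\<close> never occur in
  \<open>rs\<close>; they are assigned from the start.\<close>

definition pending :: "nat list \<Rightarrow> (nat \<Rightarrow> nat) \<Rightarrow> bool" where
  "pending rs f \<longleftrightarrow> set rs \<subseteq> excs \<union> aexcs \<and> sorted_wrt before rs \<and>
     (\<forall>d \<in> excs \<union> aexcs - set rs. \<forall>r \<in> set rs. before d r) \<and>
     partial_perm ({1..n} - set rs) f \<and> (\<forall>i. i \<notin> {1..n} \<longrightarrow> f i = i)"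

lemma before_irrefl: "\<not> before i i"
  using position_sets_disjoint by (auto simp: before_def)

lemma sorted_before_distinct: "sorted_wrt before rs \<Longrightarrow> distinct rs"
  by (induction rs) (auto simp: before_irrefl)

lemma pending_initial:
  "pending (sorted_list_of_set aexcs @ rev (sorted_list_of_set excs)) id"
proof -
  have "sorted_wrt before (sorted_list_of_set aexcs)"
    by (rule sorted_wrt_mono_rel[OF _ strict_sorted_list_of_set]) (auto simp: before_def)
  moreover have "sorted_wrt before (rev (sorted_list_of_set excs))"
    unfolding sorted_wrt_rev
    by (rule sorted_wrt_mono_rel[OF _ strict_sorted_list_of_set]) (auto simp: before_def)
  ultimately show ?thesis
    by (auto simp: pending_def sorted_wrt_append before_def partial_perm_def)
qed

lemma pending_placed_aexc:
  assumes "pending (p # rs) f" "p \<in> aexcs"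
  shows "i \<in> aexcs \<Longrightarrow> i \<notin> set (p # rs) \<longleftrightarrow> i < p" and "excs \<subseteq> set (p # rs)"
  using assms position_sets_disjoint unfolding pending_def
  by (auto simp: before_def)

lemma pending_placed_exc:
  assumes "pending (p # rs) f" "p \<in> excs"
  shows "i \<in> excs \<Longrightarrow> i \<notin> set (p # rs) \<longleftrightarrow> p < i" and "aexcs \<inter> set (p # rs) = {}"
  using assms position_sets_disjoint unfolding pending_def
  by (auto simp: before_def)

text \<open>The two kinds of values are disjoint and fixed points use neither, so a new value can
  only clash with one placed at a position of its own kind.\<close>

lemma partial_perm_avoids:
  assumes f: "partial_perm A f" and A: "A \<subseteq> {1..n}"
  shows "v \<in> aexc_values \<Longrightarrow> v \<notin> f ` (A \<inter> aexcs) \<Longrightarrow> v \<notin> f ` A"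
    and "v \<in> exc_values \<Longrightarrow> v \<notin> f ` (A \<inter> excs) \<Longrightarrow> v \<notin> f ` A"
proof -
  have Fix: "f i = i \<and> i \<notin> exc_values \<and> i \<notin> aexc_values" if "i \<in> A" "i \<notin> excs" "i \<notin> aexcs" for i
    using that f A not_exc_iff[of i] unfolding partial_perm_def by blast
  have img: "(i \<in> excs \<longrightarrow> f i \<notin> aexc_values) \<and> (i \<in> aexcs \<longrightarrow> f i \<notin> exc_values)" if "i \<in> A" for i
    using f that position_sets_disjoint(2) unfolding partial_perm_def by blast
  show "v \<notin> f ` A" if "v \<in> aexc_values" "v \<notin> f ` (A \<inter> aexcs)"
  proof
    assume "v \<in> f ` A"
    then obtain i where i: "i \<in> A" "v = f i" by blast
    thus False using Fix[of i] img[of i] that by (cases "i \<in> aexcs") auto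
  qed
  show "v \<notin> f ` A" if "v \<in> exc_values" "v \<notin> f ` (A \<inter> excs)"
  proof
    assume "v \<in> f ` A"
    then obtain i where i: "i \<in> A" "v = f i" by blast
    thus False using Fix[of i] img[of i] that by (cases "i \<in> excs") auto
  qed
qed

lemma partial_perm_inj: "partial_perm A f \<Longrightarrow> inj_on f A"
  by (simp add: partial_perm_def)

lemma partial_perm_insert:
  assumes f: "partial_perm A f" and p: "p \<notin> A" "p \<in> excs \<union> aexcs" and v: "v \<notin> f ` A"
    and "p \<in> excs \<Longrightarrow> p < v \<and> v \<in> exc_values" "p \<in> aexcs \<Longrightarrow> v < p \<and> v \<in> aexc_values"
  shows "partial_perm (insert p A) (f(p := v))"
proof -
  have eq: "(f(p := v)) i = f i" if "i \<in> A" for i using that p(1) by auto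
  have "(f(p := v)) ` A = f ` A" using eq by (rule image_cong[OF refl])
  moreover have "inj_on (f(p := v)) A"
    using inj_on_cong[of A "f(p := v)" f] eq partial_perm_inj[OF f] by blast
  ultimately have "inj_on (f(p := v)) (insert p A)"
    using p(1) v by (simp add: inj_on_insert)
  thus ?thesis
    unfolding partial_perm_def using f eq assms(5,6) p(2) by (auto simp: partial_perm_def)
qed

lemma pending_place:
  assumes P: "pending (p # rs) f" and v: "v \<notin> f ` ({1..n} - set (p # rs))"
    and "p \<in> excs \<Longrightarrow> p < v \<and> v \<in> exc_values" "p \<in> aexcs \<Longrightarrow> v < p \<and> v \<in> aexc_values"
  shows "pending rs (f(p := v))"
proof -
  have p: "p \<in> excs \<union> aexcs" "p \<notin> set rs"
    using P sorted_before_distinct[of "p # rs"] by (auto simp: pending_def)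
  have p1: "p \<in> {1..n}" using p position_sets_subset by auto
  have A: "{1..n} - set rs = insert p ({1..n} - set (p # rs))" using p p1 by auto
  have f: "partial_perm ({1..n} - set (p # rs)) f" using P by (simp add: pending_def)
  have "partial_perm ({1..n} - set rs) (f(p := v))"
    unfolding A by (rule partial_perm_insert[OF f _ p(1) v assms(3,4)]) simp
  moreover have "\<forall>d \<in> excs \<union> aexcs - set rs. \<forall>r \<in> set rs. before d r"
    using P by (auto simp: pending_def)
  moreover have "\<forall>i. i \<notin> {1..n} \<longrightarrow> (f(p := v)) i = i"
    using P p1 by (auto simp: pending_def)
  ultimately show ?thesis using P by (simp add: pending_def)
qed

section \<open>The available values and the distinguished one among them\<close>

definition extends :: "nat list \<Rightarrow> (nat \<Rightarrow> nat) \<Rightarrow> (nat \<Rightarrow> nat) \<Rightarrow> bool" where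
  "extends rs f \<sigma> \<longleftrightarrow> \<sigma> \<in> perms \<and> (\<forall>i. i \<notin> set rs \<longrightarrow> \<sigma> i = f i)"

definition aexc_choices :: "(nat \<Rightarrow> nat) \<Rightarrow> nat \<Rightarrow> nat set" where
  "aexc_choices f p = {v \<in> aexc_values. v < p} - f ` {i \<in> aexcs. i < p}"

definition exc_choices :: "(nat \<Rightarrow> nat) \<Rightarrow> nat \<Rightarrow> nat set" where
  "exc_choices f p = {v \<in> exc_values. p < v} - f ` {i \<in> excs. p < i}"

lemma finite_choices [simp]: "finite (aexc_choices f p)" "finite (exc_choices f p)"
  by (simp_all add: aexc_choices_def exc_choices_def)

lemma aexc_choices_pending:
  assumes P: "pending (p # rs) f" and p: "p \<in> aexcs" and v: "v \<in> aexc_choices f p"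
  shows "pending rs (f(p := v))"
proof (rule pending_place[OF P])
  have f: "partial_perm ({1..n} - set (p # rs)) f" using P by (simp add: pending_def)
  have "({1..n} - set (p # rs)) \<inter> aexcs \<subseteq> {i \<in> aexcs. i < p}"
    using pending_placed_aexc(1)[OF P p] by auto
  thus "v \<notin> f ` ({1..n} - set (p # rs))"
    using v by (intro partial_perm_avoids(1)[OF f]) (auto simp: aexc_choices_def)
qed (use p v position_sets_disjoint in \<open>auto simp: aexc_choices_def\<close>)

lemma exc_choices_pending:
  assumes P: "pending (p # rs) f" and p: "p \<in> excs" and v: "v \<in> exc_choices f p"
  shows "pending rs (f(p := v))"
proof (rule pending_place[OF P])
  have f: "partial_perm ({1..n} - set (p # rs)) f" using P by (simp add: pending_def)
  have "({1..n} - set (p # rs)) \<inter> excs \<subseteq> {i \<in> excs. p < i}"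
    using pending_placed_exc(1)[OF P p] by auto
  thus "v \<notin> f ` ({1..n} - set (p # rs))"
    using v by (intro partial_perm_avoids(2)[OF f]) (auto simp: exc_choices_def)
qed (use p v position_sets_disjoint in \<open>auto simp: exc_choices_def\<close>)

text \<open>The anti-excedances before \<open>p\<close> are all placed, with values below themselves
  and hence below \<open>p\<close>. Each removes one value, the falls cancel, and valleys minus
  peaks before \<open>p\<close> remain.\<close>

lemma card_aexc_choices:
  assumes P: "pending (p # rs) f" and p: "p \<in> aexcs"
  shows "card (aexc_choices f p) = height (p - 1)"
proof -
  let ?I = "{1..p-1}"
  let ?E = "{j \<in> ?I. \<tau> j \<in> {Peak, Fall}}" and ?V = "{j \<in> ?I. \<tau> j \<in> {Valley, Fall}}"
  have f: "partial_perm ({1..n} - set (p # rs)) f" using P by (simp add: pending_def)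
  have E: "?E = {j \<in> aexcs. j < p}" and V: "?V = {j \<in> aexc_values. j < p}"
    using position_sets_subset(3)[OF p] by (auto simp: position_sets)
  have sub: "?E \<subseteq> {1..n} - set (p # rs)"
    unfolding E using pending_placed_aexc(1)[OF P p] position_sets_subset(3) by auto
  have "f i < i \<and> f i \<in> aexc_values" if "i \<in> ?E" for i
    using f sub that unfolding partial_perm_def E by blast
  hence "f ` ?E \<subseteq> ?V" unfolding E V by fastforce
  moreover have "card (f ` ?E) = card ?E"
    by (rule card_image[OF inj_on_subset[OF partial_perm_inj[OF f] sub]])
  ultimately have "card (aexc_choices f p) = card ?V - card ?E"
    unfolding aexc_choices_def E[symmetric] V[symmetric] by (simp add: card_Diff_subset)
  thus ?thesis unfolding height_def by (simp only: card_two_types finite_atLeastAtMost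
    cycle_type.distinct not_False_eq_True add_diff_cancel_right)
qed

text \<open>The mirror count gives peaks minus valleys beyond \<open>p\<close>; as the whole word is
  balanced, this is valleys minus peaks up to and including \<open>p\<close>.\<close>

lemma card_exc_choices:
  assumes P: "pending (p # rs) f" and p: "p \<in> excs"
    and bal: "card {j \<in> {1..n}. \<tau> j = Valley} = card {j \<in> {1..n}. \<tau> j = Peak}"
  shows "card (exc_choices f p) = height p"
proof -
  let ?I = "{p<..n}"
  let ?E = "{j \<in> ?I. \<tau> j \<in> {Valley, Rise}}" and ?V = "{j \<in> ?I. \<tau> j \<in> {Peak, Rise}}"
  have f: "partial_perm ({1..n} - set (p # rs)) f" using P by (simp add: pending_def)
  have E: "?E = {j \<in> excs. p < j}" and V: "?V = {j \<in> exc_values. p < j}"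
    by (auto simp: position_sets)
  have sub: "?E \<subseteq> {1..n} - set (p # rs)"
    unfolding E using pending_placed_exc(1)[OF P p] position_sets_subset(1) by auto
  have "i < f i \<and> f i \<in> exc_values" if "i \<in> ?E" for i
    using f sub that unfolding partial_perm_def E by blast
  hence "f ` ?E \<subseteq> ?V" unfolding E V by fastforce
  moreover have "card (f ` ?E) = card ?E"
    by (rule card_image[OF inj_on_subset[OF partial_perm_inj[OF f] sub]])
  ultimately have "card (exc_choices f p) = card ?V - card ?E"
    unfolding exc_choices_def E[symmetric] V[symmetric] by (simp add: card_Diff_subset)
  also have "\<dots> = card {j \<in> ?I. \<tau> j = Peak} - card {j \<in> ?I. \<tau> j = Valley}"
    by (simp only: card_two_types finite_greaterThanAtMost
      cycle_type.distinct not_False_eq_True add_diff_cancel_right)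
  also have "\<dots> = height p"
  proof -
    have split: "card {j \<in> {1..n}. \<tau> j = t} = card {j \<in> {1..p}. \<tau> j = t} + card {j \<in> ?I. \<tau> j = t}" for t
    proof -
      have "{j \<in> {1..n}. \<tau> j = t} = {j \<in> {1..p}. \<tau> j = t} \<union> {j \<in> ?I. \<tau> j = t}"
        using position_sets_subset(1)[OF p] by auto
      thus ?thesis by (auto simp: card_Un_disjoint disjoint_iff)
    qed
    show ?thesis
      using bal split[of Valley] split[of Peak] unfolding height_def by linarith
  qed
  finally show ?thesis .
qed

text \<open>In a completed permutation the choices at \<open>p\<close> are exactly the values below
  \<open>p\<close> taken at positions from \<open>p\<close> on. Later values that are at least
  \<open>p\<close> exceed \<open>\<sigma> p\<close> anyway, so being an antirecord only means being
  the least choice.\<close>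

lemma extends_aexc:
  assumes P: "pending (p # rs) f" and p: "p \<in> aexcs" and \<sigma>: "extends (p # rs) f \<sigma>"
  shows "\<sigma> p \<in> aexc_choices f p"
    and "is_antirecord n \<sigma> p \<longleftrightarrow> \<sigma> p = Min (aexc_choices f p)"
proof -
  have perm: "\<sigma> \<in> perms" using \<sigma> by (simp add: extends_def)
  have agree: "f i = \<sigma> i" if "i \<in> aexcs" "i < p" for i
    using \<sigma> pending_placed_aexc(1)[OF P p that(1)] that(2) unfolding extends_def by metis
  note \<sigma>D = permsD[OF perm] and pre = perms_preimage[OF perm]
  have aexcD: "\<sigma> i < i \<and> \<sigma> i \<in> aexc_values" if "i \<in> aexcs" for i
    using \<sigma>D(3) that position_sets_subset(3)[OF that] by (auto simp: partial_perm_def)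
  have aexcI: "i \<in> aexcs" if "i \<in> {1..n}" "\<sigma> i < i" for i
    using \<sigma>D(3) that unfolding partial_perm_def by fastforce
  have "aexc_choices f p = {v \<in> aexc_values. v < p} - \<sigma> ` {i \<in> aexcs. i < p}"
    unfolding aexc_choices_def using agree by (auto simp: image_iff)
  hence choices: "aexc_choices f p = \<sigma> ` {i \<in> aexcs. p \<le> i \<and> \<sigma> i < p}"
    using pre aexcD \<sigma>D(2) by (auto simp: inj_eq image_iff not_less) (metis leI)
  thus mem: "\<sigma> p \<in> aexc_choices f p" using p aexcD by auto
  show "is_antirecord n \<sigma> p \<longleftrightarrow> \<sigma> p = Min (aexc_choices f p)"
  proof
    assume anti: "is_antirecord n \<sigma> p"
    have "\<sigma> p \<le> v" if v: "v \<in> aexc_choices f p" for v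
    proof -
      obtain i where "v = \<sigma> i" "i \<in> aexcs" "p \<le> i" using v choices by auto
      thus ?thesis using anti position_sets_subset(3)[of i]
        by (cases "i = p") (auto simp: is_antirecord_def less_imp_le)
    qed
    thus "\<sigma> p = Min (aexc_choices f p)" using mem by (intro Min_eqI[symmetric]) auto
  next
    assume min: "\<sigma> p = Min (aexc_choices f p)"
    show "is_antirecord n \<sigma> p" unfolding is_antirecord_def
    proof (intro ballI impI)
      fix j assume j: "j \<in> {1..n}" "p < j"
      show "\<sigma> p < \<sigma> j"
      proof (cases "\<sigma> j < p")
        case True
        hence "\<sigma> j \<in> aexc_choices f p" using j aexcI[of j] choices by auto
        hence "\<sigma> p \<le> \<sigma> j" using min by simp
        moreover have "\<sigma> p \<noteq> \<sigma> j" using j \<sigma>D(2) by (simp add: inj_eq)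
        ultimately show ?thesis by simp
      qed (use aexcD[OF p] in simp)
    qed
  qed
qed

text \<open>The mirror image: the choices are the values above \<open>p\<close> taken at positions
  up to \<open>p\<close>, and earlier values that are at most \<open>p\<close> cannot exceed
  \<open>\<sigma> p\<close>.\<close>

lemma extends_exc:
  assumes P: "pending (p # rs) f" and p: "p \<in> excs" and \<sigma>: "extends (p # rs) f \<sigma>"
  shows "\<sigma> p \<in> exc_choices f p"
    and "is_record n \<sigma> p \<longleftrightarrow> \<sigma> p = Max (exc_choices f p)"
proof -
  have perm: "\<sigma> \<in> perms" using \<sigma> by (simp add: extends_def)
  have agree: "f i = \<sigma> i" if "i \<in> excs" "p < i" for i
    using \<sigma> pending_placed_exc(1)[OF P p that(1)] that(2) unfolding extends_def by metis
  note \<sigma>D = permsD[OF perm] and pre = perms_preimage[OF perm]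
  have excD: "i < \<sigma> i \<and> \<sigma> i \<in> exc_values" if "i \<in> excs" for i
    using \<sigma>D(3) that position_sets_subset(1)[OF that] by (auto simp: partial_perm_def)
  have excI: "i \<in> excs" if "i \<in> {1..n}" "i < \<sigma> i" for i
    using \<sigma>D(3) that unfolding partial_perm_def by fastforce
  have "exc_choices f p = {v \<in> exc_values. p < v} - \<sigma> ` {i \<in> excs. p < i}"
    unfolding exc_choices_def using agree by (auto simp: image_iff)
  hence choices: "exc_choices f p = \<sigma> ` {i \<in> excs. i \<le> p \<and> p < \<sigma> i}"
    using pre excD \<sigma>D(2) by (auto simp: inj_eq image_iff not_less) (metis leI)
  thus mem: "\<sigma> p \<in> exc_choices f p" using p excD by auto
  show "is_record n \<sigma> p \<longleftrightarrow> \<sigma> p = Max (exc_choices f p)"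
  proof
    assume rec: "is_record n \<sigma> p"
    have "v \<le> \<sigma> p" if v: "v \<in> exc_choices f p" for v
    proof -
      obtain i where "v = \<sigma> i" "i \<in> excs" "i \<le> p" using v choices by auto
      thus ?thesis using rec position_sets_subset(1)[of i]
        by (cases "i = p") (auto simp: is_record_def less_imp_le)
    qed
    thus "\<sigma> p = Max (exc_choices f p)" using mem by (intro Max_eqI[symmetric]) auto
  next
    assume max: "\<sigma> p = Max (exc_choices f p)"
    show "is_record n \<sigma> p" unfolding is_record_def
    proof (intro ballI impI)
      fix j assume j: "j \<in> {1..n}" "j < p"
      show "\<sigma> j < \<sigma> p"
      proof (cases "p < \<sigma> j")
        case True
        hence "\<sigma> j \<in> exc_choices f p" using j excI[of j] choices by auto
        hence "\<sigma> j \<le> \<sigma> p" using max by simp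
        moreover have "\<sigma> p \<noteq> \<sigma> j" using j \<sigma>D(2) by (simp add: inj_eq)
        ultimately show ?thesis by simp
      qed (use excD[OF p] in simp)
    qed
  qed
qed

text \<open>
  When the valley \<open>p\<close> receives its value, \<open>p\<close> ends a path of already placed arrows. A path that
  is below \<open>p\<close> stays below \<open>p\<close>, as only anti-excedances are placed there; hence this path starts at
  a vertex \<open>s > p\<close>, and choosing \<open>s\<close> as the value of \<open>p\<close> closes a cycle with minimum \<open>p\<close>.
\<close>

lemma cycle_min_choice:
  assumes P: "pending (p # rs) f" and p: "p \<in> excs" "\<tau> p = Valley"
    and bal: "card {j \<in> {1..n}. \<tau> j = Valley} = card {j \<in> {1..n}. \<tau> j = Peak}"
  obtains s where "s \<in> exc_choices f p"
    and "\<And>\<sigma>. extends (p # rs) f \<sigma> \<Longrightarrow> cycle_min \<sigma> p \<longleftrightarrow> \<sigma> p = s"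
proof -
  \<comment> \<open>\<open>D\<close> holds the positions already assigned, \<open>E\<close> their
    arrows, and \<open>A\<close> the vertices from which placed arrows lead to
    \<open>p\<close>.\<close>
  define D where "D = {1..n} - set (p # rs)"
  define E where "E = {(i, f i) | i. i \<in> D}"
  define A where "A = {a. (a, p) \<in> E\<^sup>*}"
  have f: "partial_perm D f" using P by (simp add: pending_def D_def)
  have aexcs_D: "aexcs \<subseteq> D"
    using pending_placed_exc(2)[OF P p(1)] position_sets_subset(3) by (auto simp: D_def)
  have excs_D: "i \<in> D \<longleftrightarrow> p < i" if "i \<in> excs" for i
    using pending_placed_exc(1)[OF P p(1) that] position_sets_subset(1)[OF that] by (simp add: D_def)
  have p1: "p \<in> {1..n}" using position_sets_subset(1)[OF p(1)] by simp
  have A_sub: "A \<subseteq> insert p D"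
    unfolding A_def by (auto elim!: converse_rtranclE simp: E_def)
  have fin: "finite A" using A_sub by (rule finite_subset) (simp add: D_def)
  have pA: "p \<in> A" by (simp add: A_def)
  have pD: "p \<notin> D" by (simp add: D_def)
  have below: "b < p" if "(a, b) \<in> E\<^sup>*" "a < p" for a b
    using that
  proof (induction rule: rtrancl_induct)
    case (step b c)
    hence b: "b \<in> D" "c = f b" "b < p" by (auto simp: E_def)
    hence "b \<notin> excs" using excs_D[of b] by auto
    hence "f b \<le> b" using f b(1) unfolding partial_perm_def by (cases "b \<in> aexcs") auto
    thus ?case using b by simp
  qed simp
  have A_ge: "p \<le> a" if "a \<in> A" for a
    using below[of a p] that by (auto simp: A_def not_less[symmetric])
  \<comment> \<open>Otherwise every vertex of \<open>A\<close> has a placed predecessor. It lies in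
    \<open>A\<close> and differs from the unplaced \<open>p\<close>, so \<open>A\<close> would be
    the image of a smaller set.\<close>
  have "\<exists>s\<in>A. s \<notin> f ` D"
  proof (rule ccontr)
    assume *: "\<not> (\<exists>s\<in>A. s \<notin> f ` D)"
    have "A \<subseteq> f ` (A - {p})"
    proof
      fix a assume a: "a \<in> A"
      then obtain b where b: "b \<in> D" "a = f b" using * by auto
      hence "(b, a) \<in> E" by (auto simp: E_def)
      hence "b \<in> A" using a by (auto simp: A_def intro: converse_rtrancl_into_rtrancl)
      thus "a \<in> f ` (A - {p})" using b pD by auto
    qed
    hence "card A \<le> card (A - {p})" using fin by (intro surj_card_le) auto
    thus False using card_Diff1_less[OF fin pA] by simp
  qed
  then obtain s where s: "s \<in> A" "s \<notin> f ` D" by blast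
  have s1: "s \<in> {1..n}" using s(1) A_sub p1 by (auto simp: D_def)
  have "f ` aexcs = aexc_values"
  proof (rule card_subset_eq)
    show "f ` aexcs \<subseteq> aexc_values" using f aexcs_D by (auto simp: partial_perm_def)
    have "card (f ` aexcs) = card aexcs"
      by (rule card_image[OF inj_on_subset[OF partial_perm_inj[OF f] aexcs_D]])
    also have "\<dots> = card aexc_values"
      unfolding aexcs_def aexc_values_def by (simp only: card_two_types finite_atLeastAtMost
        cycle_type.distinct not_False_eq_True bal)
    finally show "card (f ` aexcs) = card aexc_values" .
  qed simp
  hence "s \<notin> aexc_values" using s(2) aexcs_D by blast
  hence "s \<noteq> p" using p p1 by (auto simp: aexc_values_def)
  hence sD: "s \<in> D" and ps: "p < s" using s(1) A_sub A_ge[of s] by auto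
  have "\<tau> s \<noteq> Fix"
  proof
    assume "\<tau> s = Fix"
    hence "f s = s" using not_exc_iff(1)[OF s1] f sD by (auto simp: partial_perm_def)
    thus False using s(2) sD by (metis imageI)
  qed
  hence "s \<in> exc_values" using not_exc_iff(2)[OF s1] \<open>s \<notin> aexc_values\<close> by blast
  hence mem: "s \<in> exc_choices f p"
    using ps s(2) excs_D by (auto simp: exc_choices_def)
  have "cycle_min \<sigma> p \<longleftrightarrow> \<sigma> p = s" if \<sigma>: "extends (p # rs) f \<sigma>" for \<sigma>
  proof
    have agree: "\<sigma> i = f i" if "i \<in> D" for i using \<sigma> that by (auto simp: extends_def D_def)
    have perm: "\<sigma> permutes {1..n}" using \<sigma> permsD(1) by (auto simp: extends_def)
    {
      assume closed: "\<sigma> p = s"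
      \<comment> \<open>Closing the path keeps the cycle of \<open>p\<close> inside
        \<open>A\<close>, which has no vertex below \<open>p\<close>.\<close>
      have "a \<in> A" if "a \<in> orbit \<sigma> p" for a
        using that
      proof induction
        case base
        thus ?case using closed s(1) by simp
      next
        case (step a)
        show ?case
        proof (cases "a = p")
          case False
          have "(a, p) \<in> E\<^sup>*" using step.IH by (simp add: A_def)
          then obtain b where "(a, b) \<in> E" "(b, p) \<in> E\<^sup>*"
            using False by (auto elim: converse_rtranclE)
          thus ?thesis using agree by (auto simp: E_def A_def)
        qed (use closed s(1) in simp)
      qed
      thus "cycle_min \<sigma> p" using A_ge by (auto simp: cycle_min_def)
    }
    assume min: "cycle_min \<sigma> p"
    have "b = a \<or> b \<in> orbit \<sigma> a" if "(a, b) \<in> E\<^sup>*" for a b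
      using that
    proof (induction rule: rtrancl_induct)
      case (step b c)
      hence "c = \<sigma> b" using agree by (auto simp: E_def)
      thus ?case using step.IH by (auto intro: orbit.intros)
    qed simp
    hence "p \<in> orbit \<sigma> s" using s(1) \<open>s \<noteq> p\<close> by (auto simp: A_def)
    hence "s \<in> orbit \<sigma> p"
      using orbit_swap[OF permutation_self_in_orbit[OF permutes_imp_permutation[OF _ perm]]] by simp
    \<comment> \<open>The predecessor \<open>y\<close> of \<open>s\<close> on the cycle is not
      placed, so it is an excedance with \<open>y \<le> p\<close>; minimality of \<open>p\<close>
      leaves only \<open>y = p\<close>.\<close>
    then obtain y where y: "\<sigma> y = s" "y = p \<or> y \<in> orbit \<sigma> p" by (auto elim: orbit.cases)
    have "y \<in> {1..n}" using y(1) s1 permutes_in_image[OF perm, of y] by simp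
    moreover have "y \<notin> D" using y(1) s(2) agree by (metis imageI)
    ultimately have "y \<in> set (p # rs)" by (simp add: D_def)
    hence "y \<in> excs" using P pending_placed_exc(2)[OF P p(1)] by (auto simp: pending_def)
    hence "y \<le> p" using excs_D[of y] \<open>y \<notin> D\<close> by simp
    moreover have "p \<le> y" using y(2) min by (auto simp: cycle_min_def)
    ultimately show "\<sigma> p = s" using y(1) by simp
  qed
  thus ?thesis using that mem by blast
qed

lemma pending_step:
  fixes a b :: "cycle_type \<Rightarrow> 'a::comm_ring_1"
  assumes P: "pending (p # rs) f"
    and bal: "card {j \<in> {1..n}. \<tau> j = Valley} = card {j \<in> {1..n}. \<tau> j = Peak}"
  shows "\<exists>Opts \<omega>. finite Opts \<and> (\<forall>v\<in>Opts. pending rs (f(p := v))) \<and>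
    (\<Sum>v\<in>Opts. \<omega> v) = step_weight a b w (\<tau> p) (height (p - 1)) (height p) \<and>
    (\<forall>\<sigma>\<in>perms. (\<forall>i. i \<notin> set (p # rs) \<longrightarrow> \<sigma> i = f i) \<longrightarrow>
       \<sigma> p \<in> Opts \<and> index_weight a b w n \<sigma> p = \<omega> (\<sigma> p))"
proof -
  have p: "p \<in> excs \<union> aexcs" using P by (simp add: pending_def)
  hence p1: "p \<in> {1..n}" using position_sets_subset by auto
  let ?c = "step_weight a b w (\<tau> p) (height (p - 1)) (height p)"
  \<comment> \<open>It suffices to name the set of options and the single option \<open>t\<close>
    that makes \<open>p\<close> distinguished.\<close>
  have suff: ?thesis
    if O: "finite Opts" "\<And>v. v \<in> Opts \<Longrightarrow> pending rs (f(p := v))" "Opts \<noteq> {} \<Longrightarrow> t \<in> Opts"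
      "level_weight (a (\<tau> p)) (b (\<tau> p)) (card Opts) = ?c"
      "\<And>\<sigma>. extends (p # rs) f \<sigma> \<Longrightarrow> \<sigma> p \<in> Opts \<and> (distinguished n \<sigma> (\<tau> p) p \<longleftrightarrow> \<sigma> p = t)"
    for Opts t
  proof (intro exI[of _ Opts] exI[of _ "\<lambda>v. if v = t then a (\<tau> p) else b (\<tau> p)"] conjI ballI impI)
    show "(\<Sum>v\<in>Opts. if v = t then a (\<tau> p) else b (\<tau> p)) = ?c"
      using O(4) by (simp add: sum_distinguished_choice[OF O(1,3)])
    fix \<sigma> assume "\<sigma> \<in> perms" "\<forall>i. i \<notin> set (p # rs) \<longrightarrow> \<sigma> i = f i"
    hence \<sigma>: "extends (p # rs) f \<sigma>" by (simp add: extends_def)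
    show "\<sigma> p \<in> Opts" using O(5)[OF \<sigma>] by simp
    have "cycle_type_of \<sigma> p = \<tau> p" using \<open>\<sigma> \<in> perms\<close> p1 by (simp add: perms_def)
    moreover have "\<tau> p \<noteq> Fix" using p by (auto simp: position_sets)
    ultimately show "index_weight a b w n \<sigma> p = (if \<sigma> p = t then a (\<tau> p) else b (\<tau> p))"
      using O(5)[OF \<sigma>] by (simp add: index_weight_def Let_def)
  qed (use O in auto)
  show ?thesis
  proof (cases "p \<in> aexcs")
    case True
    hence ty: "\<tau> p = Peak \<or> \<tau> p = Fall" by (simp add: position_sets)
    show ?thesis
    proof (rule suff[of "aexc_choices f p" "Min (aexc_choices f p)"])
      show "level_weight (a (\<tau> p)) (b (\<tau> p)) (card (aexc_choices f p)) = ?c"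
        using ty by (auto simp: card_aexc_choices[OF P True] step_weight_def)
    qed (use ty extends_aexc[OF P True] aexc_choices_pending[OF P True] in \<open>auto simp: distinguished_def\<close>)
  next
    case False
    hence exc: "p \<in> excs" using p by blast
    hence ty: "\<tau> p = Valley \<or> \<tau> p = Rise" by (simp add: position_sets)
    have c: "level_weight (a (\<tau> p)) (b (\<tau> p)) (card (exc_choices f p)) = ?c"
      using ty by (auto simp: card_exc_choices[OF P exc bal] step_weight_def)
    show ?thesis
    proof (cases "\<tau> p = Valley")
      case True
      obtain s where "s \<in> exc_choices f p"
        and "\<And>\<sigma>. extends (p # rs) f \<sigma> \<Longrightarrow> cycle_min \<sigma> p \<longleftrightarrow> \<sigma> p = s"
        using cycle_min_choice[OF P exc True bal] by blast
      thus ?thesis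
        using c extends_exc(1)[OF P exc] exc_choices_pending[OF P exc] True
        by (intro suff[of "exc_choices f p" s]) (auto simp: distinguished_def)
    next
      case False
      show ?thesis
        by (rule suff[of "exc_choices f p" "Max (exc_choices f p)"])
          (use False ty c extends_exc[OF P exc] exc_choices_pending[OF P exc] in
            \<open>auto simp: distinguished_def\<close>)
    qed
  qed
qed

lemma finite_perms: "finite perms"
  by (rule finite_subset[OF _ finite_permutations[of "{1..n}"]]) (auto simp: perms_def)

text \<open>The weights of fixed points depend only on the word and factor out; the other positions
  are handled by successive choices starting from \<open>id\<close>. An unbalanced word admits no
  permutation.\<close>

lemma sum_perms_weight:
  fixes a b :: "cycle_type \<Rightarrow> 'a::comm_ring_1"
  shows "(\<Sum>\<sigma>\<in>perms. \<Prod>i\<in>{1..n}. index_weight a b w n \<sigma> i) =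
    (if card {j \<in> {1..n}. \<tau> j = Valley} = card {j \<in> {1..n}. \<tau> j = Peak}
     then \<Prod>i\<in>{1..n}. step_weight a b w (\<tau> i) (height (i - 1)) (height i) else 0)"
proof (cases "card {j \<in> {1..n}. \<tau> j = Valley} = card {j \<in> {1..n}. \<tau> j = Peak}")
  case bal: True
  let ?rs = "sorted_list_of_set aexcs @ rev (sorted_list_of_set excs)"
  let ?c = "\<lambda>i. step_weight a b w (\<tau> i) (height (i - 1)) (height i)"
  let ?X = "{i \<in> {1..n}. \<tau> i = Fix}"
  have split: "(\<Prod>i\<in>{1..n}. g i) = (\<Prod>i\<in>?X. g i) * (\<Prod>i\<in>set ?rs. g i)" for g :: "nat \<Rightarrow> 'a"
  proof -
    have "i \<in> {1..n} \<longleftrightarrow> i \<in> ?X \<union> set ?rs" for i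
      using not_exc_iff(1)[of i] position_sets_subset(1,3)[of i] by auto
    hence "{1..n} = ?X \<union> set ?rs" by blast
    moreover have "?X \<inter> set ?rs = {}" using not_exc_iff(1) by auto
    ultimately show ?thesis by (metis finite_Un finite_atLeastAtMost prod.union_disjoint)
  qed
  have X: "(\<Prod>i\<in>?X. index_weight a b w n \<sigma> i) = (\<Prod>i\<in>?X. ?c i)" if "\<sigma> \<in> perms" for \<sigma>
    using that by (intro prod.cong refl)
      (auto simp: index_weight_def step_weight_def psnest_eq_height perms_def)
  have all: "{\<sigma>. \<sigma> \<in> perms \<and> (\<forall>i. i \<notin> set ?rs \<longrightarrow> \<sigma> i = id i)} = perms"
  proof -
    have "\<sigma> i = i" if "\<sigma> \<in> perms" "i \<notin> excs" "i \<notin> aexcs" for \<sigma> i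
      using permsD(1,3)[OF that(1)] that(2,3) permutes_not_in[of \<sigma> "{1..n}" i]
      unfolding partial_perm_def by blast
    thus ?thesis by auto
  qed
  have rest: "(\<Sum>\<sigma>\<in>perms. \<Prod>i\<in>set ?rs. index_weight a b w n \<sigma> i) = (\<Prod>i\<in>set ?rs. ?c i)"
  proof -
    have "distinct rs" if "pending rs f" for rs f
      using that sorted_before_distinct by (simp add: pending_def)
    moreover have "f \<in> perms" if "pending [] f" for f
      using that permsI by (simp add: pending_def)
    ultimately show ?thesis
      using sum_prod_successive_choices[of perms pending ?c "index_weight a b w n" ?rs id,
          OF finite_perms _ _ pending_step[OF _ bal] pending_initial]
      unfolding all by blast
  qed
  have "(\<Sum>\<sigma>\<in>perms. \<Prod>i\<in>{1..n}. index_weight a b w n \<sigma> i)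
      = (\<Sum>\<sigma>\<in>perms. (\<Prod>i\<in>?X. ?c i) * (\<Prod>i\<in>set ?rs. index_weight a b w n \<sigma> i))"
    by (rule sum.cong[OF refl]) (simp only: split X)
  also have "\<dots> = (\<Prod>i\<in>{1..n}. ?c i)"
    by (simp only: split rest sum_distrib_left[symmetric])
  finally have "(\<Sum>\<sigma>\<in>perms. \<Prod>i\<in>{1..n}. index_weight a b w n \<sigma> i) = (\<Prod>i\<in>{1..n}. ?c i)" .
  thus ?thesis using bal by simp
next
  case False
  hence "perms = {}" using perms_balanced by blast
  thus ?thesis using False by simp
qed

end

section \<open>Summation over words\<close>

definition next_height :: "cycle_type \<Rightarrow> nat \<Rightarrow> nat" where
  "next_height t h = (case t of Peak \<Rightarrow> h - 1 | Valley \<Rightarrow> Suc h | _ \<Rightarrow> h)"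

context
  fixes a b :: "cycle_type \<Rightarrow> 'a::comm_ring_1" and w :: "nat \<Rightarrow> 'a"
begin

fun path_weight :: "nat \<Rightarrow> cycle_type list \<Rightarrow> 'a" where
  "path_weight h [] = (if h = 0 then 1 else 0)"
| "path_weight h (t # ts) =
     step_weight a b w t h (next_height t h) * path_weight (next_height t h) ts"

text \<open>
  The truncated subtractions are harmless: a word that would make the height negative has a
  \<open>Peak\<close> at height 0, whose weight is 0.
\<close>

lemma path_weight_eq_prod:
  "path_weight h ts =
     (if h + count_list ts Valley = count_list ts Peak
      then \<Prod>k<length ts. step_weight a b w (ts ! k)
        (h + count_list (take k ts) Valley - count_list (take k ts) Peak)
        (h + count_list (take (Suc k) ts) Valley - count_list (take (Suc k) ts) Peak)
      else 0)"
proof (induction ts arbitrary: h)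
  case (Cons t ts)
  show ?case
  proof (cases "t = Peak \<and> h = 0")
    \<comment> \<open>Both sides vanish, the right one because its factor at \<open>k = 0\<close> is
      a peak at height 0. In the other case \<open>next_height\<close> involves no
      truncation.\<close>
    case True
    thus ?thesis
      by (simp add: prod.lessThan_Suc_shift step_weight_def level_weight_def del: prod.lessThan_Suc)
  next
    case False
    have height: "h + count_list (take (Suc k) (t # ts)) Valley - count_list (take (Suc k) (t # ts)) Peak
        = next_height t h + count_list (take k ts) Valley - count_list (take k ts) Peak" for k
      using False by (cases t) (auto simp: next_height_def)
    have end_height: "h + count_list (t # ts) Valley = count_list (t # ts) Peak
        \<longleftrightarrow> next_height t h + count_list ts Valley = count_list ts Peak"
      using False by (cases t) (auto simp: next_height_def)
    show ?thesis
      unfolding path_weight.simps Cons.IH length_Cons prod.lessThan_Suc_shift height end_height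
      by simp
  qed
qed simp

text \<open>\<open>path_weight\<close> puts the peak weights on down steps,
  \<open>motzkin_sum\<close> on the matching up steps. The \<open>h\<close> descents below the
  starting height have no matching up step, and they give the extra product.\<close>

lemma sum_path_weight:
  assumes \<gamma>: "\<And>h. \<gamma> h = level_weight (a Fall) (b Fall) h + level_weight (a Rise) (b Rise) h + w h"
    and \<beta>: "\<And>h. \<beta> (Suc h) =
      level_weight (a Peak) (b Peak) (Suc h) * level_weight (a Valley) (b Valley) (Suc h)"
  shows "(\<Sum>ts | length ts = n. path_weight h ts) =
    (\<Prod>j\<in>{1..h}. level_weight (a Peak) (b Peak) j) * motzkin_sum \<gamma> \<beta> n h"
proof (induction n arbitrary: h)
  case 0
  have "{ts :: cycle_type list. length ts = 0} = {[]}" by auto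
  thus ?case by simp
next
  case (Suc n)
  let ?L = "\<lambda>t. level_weight (a t) (b t)"
  have lists: "{ts :: cycle_type list. length ts = Suc n}
      = (\<lambda>(t, ts). t # ts) ` (UNIV \<times> {ts. length ts = n})"
    by (force simp: length_Suc_conv)
  have "(\<Sum>ts | length ts = Suc n. path_weight h ts)
      = (\<Sum>(t, ts)\<in>UNIV \<times> {ts. length ts = n}. path_weight h (t # ts))"
    unfolding lists by (subst sum.reindex) (auto simp: inj_on_def case_prod_unfold)
  also have "\<dots> = (\<Sum>t\<in>UNIV. step_weight a b w t h (next_height t h) *
      (\<Sum>ts | length ts = n. path_weight (next_height t h) ts))"
    by (simp add: sum.cartesian_product[symmetric] sum_distrib_left)
  also have "\<dots> = (\<Prod>j\<in>{1..h}. ?L Peak j) * motzkin_sum \<gamma> \<beta> (Suc n) h"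
    unfolding Suc.IH UNIV_cycle_type
    by (cases h) (simp_all add: step_weight_def next_height_def level_weight_def[of _ _ 0]
      \<gamma> \<beta> algebra_simps)
  finally show ?case .
qed

end

lemma card_type_eq_count_list:
  "k \<le> length ts \<Longrightarrow> card {j \<in> {1..k}. ts ! (j - 1) = t} = count_list (take k ts) t"
proof (induction k)
  case (Suc k)
  have "{j \<in> {1..Suc k}. ts ! (j - 1) = t}
      = {j \<in> {1..k}. ts ! (j - 1) = t} \<union> (if ts ! k = t then {Suc k} else {})"
    by (auto simp: le_Suc_eq)
  thus ?case using Suc by (auto simp: take_Suc_conv_app_nth)
qed simp

lemma sum_permutes_index_weight:
  fixes a b :: "cycle_type \<Rightarrow> 'a::comm_ring_1"
  shows "(\<Sum>\<sigma> | \<sigma> permutes {1..n}. \<Prod>i\<in>{1..n}. index_weight a b w n \<sigma> i)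
    = (\<Sum>ts | length ts = n. path_weight a b w 0 ts)"
proof -
  let ?word = "\<lambda>\<sigma>. map (cycle_type_of \<sigma>) [1..<Suc n]"
  let ?W = "\<lambda>\<sigma>. \<Prod>i\<in>{1..n}. index_weight a b w n \<sigma> i"
  have "(\<Sum>\<sigma> | \<sigma> permutes {1..n}. ?W \<sigma>)
      = (\<Sum>ts | length ts = n. \<Sum>\<sigma> | \<sigma> \<in> {\<sigma>. \<sigma> permutes {1..n}} \<and> ?word \<sigma> = ts. ?W \<sigma>)"
  proof (rule sum.group[symmetric])
    show "finite {ts :: cycle_type list. length ts = n}"
      using finite_lists_length_eq[of "UNIV :: cycle_type set" n] by simp
  qed (auto simp: finite_permutations)
  also have "\<dots> = (\<Sum>ts | length ts = n. path_weight a b w 0 ts)"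
  proof (rule sum.cong[OF refl])
    fix ts :: "cycle_type list" assume "ts \<in> {ts. length ts = n}"
    hence len: "length ts = n" by simp
    \<comment> \<open>Lists are indexed from 0, the permuted set from 1.\<close>
    define \<tau> where "\<tau> i = ts ! (i - 1)" for i
    interpret cycle_type_word n \<tau> .
    have "?word \<sigma> = ts \<longleftrightarrow> (\<forall>i\<in>{1..n}. cycle_type_of \<sigma> i = \<tau> i)" for \<sigma>
    proof -
      have "?word \<sigma> = ts \<longleftrightarrow> (\<forall>k<n. cycle_type_of \<sigma> (Suc k) = \<tau> (Suc k))"
        using len by (auto simp: \<tau>_def list_eq_iff_nth_eq simp del: upt_Suc)
      also have "\<dots> \<longleftrightarrow> (\<forall>i\<in>Suc ` {..<n}. cycle_type_of \<sigma> i = \<tau> i)" by auto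
      finally show ?thesis by (simp add: image_Suc_lessThan)
    qed
    hence "{\<sigma>. \<sigma> \<in> {\<sigma>. \<sigma> permutes {1..n}} \<and> ?word \<sigma> = ts} = perms"
      unfolding perms_def by blast
    hence "(\<Sum>\<sigma> | \<sigma> \<in> {\<sigma>. \<sigma> permutes {1..n}} \<and> ?word \<sigma> = ts. ?W \<sigma>) = (\<Sum>\<sigma>\<in>perms. ?W \<sigma>)"
      by (rule arg_cong)
    also have "\<dots> = path_weight a b w 0 ts"
    proof -
      have count: "card {j \<in> {1..k}. \<tau> j = t} = count_list (take k ts) t" if "k \<le> n" for k t
        using that len card_type_eq_count_list[of k ts t] by (simp add: \<tau>_def)
      have height: "height k = count_list (take k ts) Valley - count_list (take k ts) Peak"
        if "k \<le> n" for k
        using that by (simp only: height_def count)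
      have "(\<Prod>i\<in>{1..n}. step_weight a b w (\<tau> i) (height (i - 1)) (height i))
          = (\<Prod>k<n. step_weight a b w (\<tau> (Suc k)) (height k) (height (Suc k)))"
        by (simp add: prod.atLeast1_atMost_eq)
      also have "\<dots> = (\<Prod>k<n. step_weight a b w (ts ! k)
          (0 + count_list (take k ts) Valley - count_list (take k ts) Peak)
          (0 + count_list (take (Suc k) ts) Valley - count_list (take (Suc k) ts) Peak))"
        by (intro prod.cong refl) (simp add: height \<tau>_def)
      finally show ?thesis
        unfolding sum_perms_weight path_weight_eq_prod using len
        by (simp only: count take_all order_refl add_0)
    qed
    finally show "(\<Sum>\<sigma> | \<sigma> \<in> {\<sigma>. \<sigma> permutes {1..n}} \<and> ?word \<sigma> = ts. ?W \<sigma>)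
      = path_weight a b w 0 ts" .
  qed
  finally show ?thesis .
qed

section \<open>From the statistics to a product over indices\<close>

lemma power_card_eq_prod:
  "finite A \<Longrightarrow> x ^ card {i \<in> A. P i} = (\<Prod>i\<in>A. if P i then x else (1::'a::comm_monoid_mult))"
  by (simp add: prod.inter_filter[symmetric])

text \<open>The nested tests of \<open>cycle_type_of\<close> leave out
  \<open>inv \<sigma> i = i\<close>, which happens only at fixed points.\<close>

lemma permutes_cycle_type:
  assumes \<sigma>: "\<sigma> permutes {1..n}"
  shows "cpeak \<sigma> i \<longleftrightarrow> cycle_type_of \<sigma> i = Peak" "cval \<sigma> i \<longleftrightarrow> cycle_type_of \<sigma> i = Valley"
    "cdrise \<sigma> i \<longleftrightarrow> cycle_type_of \<sigma> i = Rise" "cdfall \<sigma> i \<longleftrightarrow> cycle_type_of \<sigma> i = Fall"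
    "\<sigma> i = i \<longleftrightarrow> cycle_type_of \<sigma> i = Fix"
proof -
  have "inv \<sigma> i = i \<longleftrightarrow> \<sigma> i = i"
    using permutes_inv_eq[OF \<sigma>] by metis
  thus "cpeak \<sigma> i \<longleftrightarrow> cycle_type_of \<sigma> i = Peak" "cval \<sigma> i \<longleftrightarrow> cycle_type_of \<sigma> i = Valley"
    "cdrise \<sigma> i \<longleftrightarrow> cycle_type_of \<sigma> i = Rise" "cdfall \<sigma> i \<longleftrightarrow> cycle_type_of \<sigma> i = Fall"
    "\<sigma> i = i \<longleftrightarrow> cycle_type_of \<sigma> i = Fix"
    by (auto simp: cpeak_def cval_def cdrise_def cdfall_def cycle_type_of_def)
qed

text \<open>Every statistic becomes a product over all indices. A peak or double fall is never a
  record and a double rise never an antirecord, so the exclusive and the neither case are told apart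
  by a single test, as in \<open>distinguished\<close>.\<close>

lemma Qtilde_eq_sum_prod:
  fixes x1 x2 y1 y2 u1 u2 v1 v2 :: "'a::comm_ring_1"
  defines "a \<equiv> \<lambda>t. case t of Peak \<Rightarrow> x1 | Fall \<Rightarrow> x2 | Valley \<Rightarrow> y1 | Rise \<Rightarrow> y2 | Fix \<Rightarrow> 0"
    and "b \<equiv> \<lambda>t. case t of Peak \<Rightarrow> u1 | Fall \<Rightarrow> u2 | Valley \<Rightarrow> v1 | Rise \<Rightarrow> v2 | Fix \<Rightarrow> 0"
  shows "Qtilde n x1 x2 y1 y2 u1 u2 v1 v2 w =
    (\<Sum>\<sigma> | \<sigma> permutes {1..n}. \<Prod>i\<in>{1..n}. index_weight a b w n \<sigma> i)"
  unfolding Qtilde_def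
proof (rule sum.cong[OF refl])
  fix \<sigma> assume "\<sigma> \<in> {\<sigma>. \<sigma> permutes {1..n}}"
  hence \<sigma>: "\<sigma> permutes {1..n}" by simp
  have fixed: "(\<Prod>i | i \<in> {1..n} \<and> \<sigma> i = i. w (psnest n i \<sigma>))
      = (\<Prod>i\<in>{1..n}. if \<sigma> i = i then w (psnest n i \<sigma>) else 1)"
    by (rule prod.inter_filter) simp
  have factor: "index_weight a b w n \<sigma> i =
      (if cpeak \<sigma> i \<and> exantirecord n \<sigma> i then x1 else 1) *
      (if cdfall \<sigma> i \<and> exantirecord n \<sigma> i then x2 else 1) *
      (if cval \<sigma> i \<and> cycle_min \<sigma> i then y1 else 1) *
      (if cdrise \<sigma> i \<and> exrecord n \<sigma> i then y2 else 1) *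
      (if cpeak \<sigma> i \<and> nrar n \<sigma> i then u1 else 1) *
      (if cdfall \<sigma> i \<and> nrar n \<sigma> i then u2 else 1) *
      (if cval \<sigma> i \<and> \<not> cycle_min \<sigma> i then v1 else 1) *
      (if cdrise \<sigma> i \<and> nrar n \<sigma> i then v2 else 1) *
      (if \<sigma> i = i then w (psnest n i \<sigma>) else 1)" if i: "i \<in> {1..n}" for i
  proof -
    have "\<not> is_record n \<sigma> i" if "cpeak \<sigma> i \<or> cdfall \<sigma> i"
      using that permutes_below_not_record[OF \<sigma> i] by (auto simp: cpeak_def cdfall_def)
    moreover have "\<not> is_antirecord n \<sigma> i" if "cdrise \<sigma> i"
      using that permutes_above_not_antirecord[OF \<sigma> i] by (auto simp: cdrise_def)
    ultimately show ?thesis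
      unfolding permutes_cycle_type[OF \<sigma>]
      by (cases "cycle_type_of \<sigma> i")
        (simp_all add: index_weight_def distinguished_def a_def b_def exantirecord_def exrecord_def nrar_def)
  qed
  show "x1 ^ eareccpeak n \<sigma> * x2 ^ eareccdfall n \<sigma> * y1 ^ minval n \<sigma> * y2 ^ ereccdrise n \<sigma> *
        u1 ^ nrcpeak n \<sigma> * u2 ^ nrcdfall n \<sigma> * v1 ^ nminval n \<sigma> * v2 ^ nrcdrise n \<sigma> *
        (\<Prod>i | i \<in> {1..n} \<and> \<sigma> i = i. w (psnest n i \<sigma>)) =
      (\<Prod>i\<in>{1..n}. index_weight a b w n \<sigma> i)"
    unfolding fixed eareccpeak_def eareccdfall_def minval_def ereccdrise_def nrcpeak_def nrcdfall_def
      nminval_def nrcdrise_def power_card_eq_prod[OF finite_atLeastAtMost] prod.distrib[symmetric]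
    by (rule prod.cong[OF refl]) (rule factor[symmetric])
qed

theorem theorem3p1:
  fixes x1 x2 y1 y2 u1 u2 v1 v2 :: "'a::comm_ring_1"
    and w \<gamma> \<beta> :: "nat \<Rightarrow> 'a"
  assumes "\<gamma> 0 = w 0"
    and "\<And>n. n \<ge> 1 \<Longrightarrow>
      \<gamma> n = (x2 + of_nat (n - 1) * u2) + (y2 + of_nat (n - 1) * v2) + w n"
    and "\<And>n. n \<ge> 1 \<Longrightarrow>
      \<beta> n = (x1 + of_nat (n - 1) * u1) * (y1 + of_nat (n - 1) * v1)"
  shows "has_Jfrac (Abs_fps (\<lambda>n. Qtilde n x1 x2 y1 y2 u1 u2 v1 v2 w)) \<gamma> \<beta>"
proof -
  define a where "a = (\<lambda>t. case t of Peak \<Rightarrow> x1 | Fall \<Rightarrow> x2 | Valley \<Rightarrow> y1 | Rise \<Rightarrow> y2 | Fix \<Rightarrow> 0)"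
  define b where "b = (\<lambda>t. case t of Peak \<Rightarrow> u1 | Fall \<Rightarrow> u2 | Valley \<Rightarrow> v1 | Rise \<Rightarrow> v2 | Fix \<Rightarrow> 0)"
  \<comment> \<open>At \<open>h = 0\<close> both level weights vanish, which leaves
    \<open>w 0\<close>.\<close>
  have \<gamma>: "\<gamma> h = level_weight (a Fall) (b Fall) h + level_weight (a Rise) (b Rise) h + w h" for h
    using assms(1,2) by (cases "h = 0") (auto simp: level_weight_def a_def b_def)
  have \<beta>: "\<beta> (Suc h) =
      level_weight (a Peak) (b Peak) (Suc h) * level_weight (a Valley) (b Valley) (Suc h)" for h
    using assms(3)[of "Suc h"] by (simp add: level_weight_def a_def b_def)
  \<comment> \<open>Paths starting at height 0 have no unmatched descents, so the extra product is
    empty.\<close>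
  have "Qtilde n x1 x2 y1 y2 u1 u2 v1 v2 w = motzkin_sum \<gamma> \<beta> n 0" for n
    using sum_path_weight[where a = a and b = b and w = w and h = 0, OF \<gamma> \<beta>]
    unfolding Qtilde_eq_sum_prod a_def[symmetric] b_def[symmetric] sum_permutes_index_weight
    by simp
  thus ?thesis using has_Jfrac_motzkin_sum by simp
qed

end
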